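(* Let $f_d$ and $\|\cdot\|$ be any two norms on $\mathbb{R}^N$ and $(\psi_i)_{i\in I}$ be a dictionary in $\mathbb{R}^N$. For any $K\in\{0,\ldots,N\}$, let $\tau>0$ and $\theta$ be such that $\theta\ge\tau\max(\Delta_K,\Delta_{K-1})$. Consider a random variable $d$ with uniform distribution on $\mathcal{L}_{f_d}(\theta)$. Then $$\frac{\overline{C}_K}{\mathbb{L}^N(\mathcal{L}_{f_d}(1))}\left(\frac{\tau}{\theta}\right)^{N-K}\left(1-\hat\delta_K\frac{\tau}{\theta}\right)^K-\varepsilon^-(K,\tau,\theta)\ \le\ \mathbb{P}\left(\mathrm{val}(\mathcal{P}_d)=K\right)\ \le\ \frac{\overline{C}_K}{\mathbb{L}^N(\mathcal{L}_{f_d}(1))}\left(\frac{\tau}{\theta}\right)^{N-K}\left(1+\hat\delta_K\frac{\tau}{\theta}\right)^K+\varepsilon^+(K,\tau,\theta)$$ with $$\varepsilon^-(K,\tau,\theta)=\frac{\varepsilon_0'(K,\tau,\theta)}{\mathbb{L}^N(\mathcal{L}_{f_d}(1))},\qquad \varepsilon^+(K,\tau,\theta)=\frac{\varepsilon_1(K,\tau,\theta)}{\mathbb{L}^N(\mathcal{L}_{f_d}(1))}.$$ In particular, $$\mathbb{P}\left(\mathrm{val}(\mathcal{P}_d)=K\right)=\frac{\overline{C}_K}{\mathbb{L}^N(\mathcal{L}_{f_d}(1))}\left(\frac{\tau}{\theta}\right)^{N-K}+o\left(\left(\frac{\tau}{\theta}\right)^{N-K}\right)\quad\text{as }\frac{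\tau}{\theta}\to0.$$
   Context: $N\ge1$ is an integer; $\|\cdot\|$ and $f_d$ are arbitrary norms on $\mathbb{R}^N$; $\|\cdot\|_2$ is the Euclidean norm; the dictionary $(\psi_i)_{i\in I}$ is a finite family in $\mathbb{R}^N$ with $\mathrm{span}\{\psi_i:i\in I\}=\mathbb{R}^N$. For $d\in\mathbb{R}^N$ and $\tau>0$, $\mathrm{val}(\mathcal{P}_d)$ is the minimum of $\#\{i\in I:\lambda_i\neq0\}$ over all $(\lambda_i)_{i\in I}\in\mathbb{R}^I$ with $\|\sum_{i\in I}\lambda_i\psi_i-d\|\le\tau$. For a function $f$, $\mathcal{L}_f(t)=\{w:f(w)\le t\}$. $P_V$ is the orthogonal projection onto a subspace $V$, $V^\bot$ the orthogonal complement. $\mathbb{L}^k$ is $k$-dimensional Lebesgue measure (on a $k$-dimensional subspace of $\mathbb{R}^N$, via identification with $\mathbb{R}^k$ by an orthonormal basis), with $\mathbb{L}^0(\{0\})=1$; zeroth powers equal $1$. For $J\subset I$: $\mathcal{T}_J=\mathrm{span}((\psi_j)_{j\in J})$ ($\mathrm{span}(\emptyset)=\{0\}$) and $\mathcal{T}_J^\tau=\mathcal{T}_J+P_{\mathcal{T}_J^\bot}(\mathcal{L}_{\|\cdot\|}(\tau))$. Constants. Fix $\delta_1,\delta_2>0$ with $f_d(w)\le\delta_1\|w\|_2$ and $\|w\|_2\le\delta_2\|w\|$ for all $w\in\mathbb{R}^N$, and let $\overline{\Delta}=\delta_1\delta_2$. For $J\subset I$, let $h_J$ be the norm on $\mathcal{T}_J^\bot$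 given by $h_J(u)=\inf\{t>0:u/t\in P_{\mathcal{T}_J^\bot}(\mathcal{L}_{\|\cdot\|}(1))\}$; $\delta_J\in[0,\overline{\Delta}]$ is a fixed constant with $f_d(u)\le\delta_Jh_J(u)$ for all $u\in\mathcal{T}_J^\bot$; and, with $K=\dim\mathcal{T}_J$, $C_J=\mathbb{L}^{N-K}\big(P_{\mathcal{T}_J^\bot}(\mathcal{L}_{\|\cdot\|}(1))\big)\,\mathbb{L}^K\big(\mathcal{T}_J\cap\mathcal{L}_{f_d}(1)\big)$. $\mathcal{J}(K)$ is a fixed collection of subsets $J\subset I$ with $\dim\mathcal{T}_J=K$, such that distinct members have distinct spans $\mathcal{T}_J$ and every $K$-dimensional subspace of the form $\mathcal{T}_{J_1}$, $J_1\subset I$, equals $\mathcal{T}_J$ for some $J\in\mathcal{J}(K)$; $\mathcal{J}(0)=\{\emptyset\}$. Set $\hat\delta_K=\max_{J\in\mathcal{J}(K)}\delta_J$ and $\overline{C}_K=\sum_{J\in\mathcal{J}(K)}C_J$. Let $k_K=\max\{0,2K-N\}$ and $\mathcal{H}(K,k)=\{(J_1,J_2)\in\mathcal{J}(K)^2:\dim(\mathcal{T}_{J_1}\cap\mathcal{T}_{J_2})=k\}$ for $0\le k\le K-1$. For $(J_1,J_2)\in\mathcal{H}(K,k)$ put $W=\mathcal{T}_{J_1}\cap\mathcal{T}_{J_2}$ and $$Q_{J_1,J_2}=\mathbb{L}^{N-k}\big(W^\bot\cap\mathcal{L}_{\|\cdot\|_2}(2\delta_2)\big)\,\mathbb{L}^k\big(W\cap\mathcal{L}_{f_d}(1)\big),$$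 and let $\delta_{J_1,J_2}\in[0,3\overline{\Delta}]$ be a fixed constant such that for all $\tau,\theta>0$ with $\theta\ge\delta_{J_1,J_2}\tau$, $$\mathbb{L}^N\big(\mathcal{T}_{J_1}^\tau\cap\mathcal{T}_{J_2}^\tau\cap\mathcal{L}_{f_d}(\theta)\big)\le Q_{J_1,J_2}\tau^{N-k}(\theta+\delta_{J_1,J_2}\tau)^k.$$ For $1\le K\le N-1$ and $k_K\le k\le K-1$: $\hat\delta'_{K,k}=\max\{0,\max_{(J_1,J_2)\in\mathcal{H}(K,k)}\delta_{J_1,J_2}\}$ and $\overline{Q}_{K,k}=\sum_{(J_1,J_2)\in\mathcal{H}(K,k)}Q_{J_1,J_2}$ (both are $0$ if $\mathcal{H}(K,k)=\emptyset$). $\Delta_0=\hat\delta_0$; $\Delta_K=\max\{\Delta_{K-1},\hat\delta_K,\max_{k_K\le k\le K-1}\hat\delta'_{K,k}\}$ for $0<K<N$; $\Delta_N=\max\{\Delta_{N-1},\hat\delta_N\}$. Error terms: $\varepsilon_0(K,\tau,\theta)=0$ if $K=0$ or $K=N$, and $\varepsilon_0(K,\tau,\theta)=\sum_{k=k_K}^{K-1}\overline{Q}_{K,k}\left(\frac{\tau}{\theta}\right)^{N-k}\left(1+\hat\delta'_{K,k}\frac{\tau}{\theta}\right)^k$ if $0<K<N$; $$\varepsilon_0'(K,\tau,\theta)=\varepsilon_0(K,\tau,\theta)+\overline{C}_{K-1}\left(\frac{\tau}{\theta}\right)^{N-(K-1)}\left(1+\hat\delta_{K-1}\frac{\tau}{\theta}\right)^{K-1},$$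 $$\varepsilon_1(K,\tau,\theta)=\varepsilon_0(K-1,\tau,\theta)-\overline{C}_{K-1}\left(\frac{\tau}{\theta}\right)^{N-(K-1)}\left(1-\hat\delta_{K-1}\frac{\tau}{\theta}\right)^{K-1}.$$ Extensions to index $-1$: $\overline{C}_{-1}=0$, $\varepsilon_0(-1,\tau,\theta)=0$, $\Delta_{-1}=0$ (terms containing the factor $\overline{C}_{-1}$ are $0$). In the asymptotic statement, $N$, $K$, the norms and the dictionary are fixed. *)

theory Defs
  imports "HOL-Probability.Probability" "HOL-Library.Landau_Symbols"
begin

text \<open>
  The ambient space is \<open>real ^ 'n\<close>, so the dimension \<open>N \<ge> 1\<close> is \<open>CARD('n)\<close>, and \<open>norm\<close> is the
  Euclidean norm. The arbitrary norms are functions \<open>nrm\<close> and \<open>fd\<close> satisfying \<open>is_norm\<close>.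
\<close>

definition is_norm :: "(real ^ 'n \<Rightarrow> real) \<Rightarrow> bool" where
  "is_norm f \<longleftrightarrow>
     (\<forall>x. 0 \<le> f x) \<and> (\<forall>x. f x = 0 \<longleftrightarrow> x = 0) \<and>
     (\<forall>c x. f (c *\<^sub>R x) = \<bar>c\<bar> * f x) \<and> (\<forall>x y. f (x + y) \<le> f x + f y)"

definition lev :: "(real ^ 'n \<Rightarrow> real) \<Rightarrow> real \<Rightarrow> (real ^ 'n) set" where
  "lev f t = {w. f w \<le> t}"

definition proj :: "(real ^ 'n) set \<Rightarrow> real ^ 'n \<Rightarrow> real ^ 'n" where
  "proj V x = (THE y. y \<in> V \<and> x - y \<in> V\<^sup>\<bottom>)"

text \<open>
  Lebesgue measure on a subspace, transported from \<open>\<real>\<^sup>B\<close> by the coordinates of an orthonormal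
  basis \<open>B\<close>. Such a basis exists by \<open>orthonormal_basis_subspace\<close>, and by rotation invariance
  the measure does not depend on which one is chosen. For \<open>V = {0}\<close> the basis is empty and the
  product measure is a unit point mass, so \<open>{0}\<close> has measure 1. The library's \<open>lborel\<close> is defined
  in the same way, from the standard basis.
\<close>

definition onb :: "(real ^ 'n) set \<Rightarrow> (real ^ 'n) set \<Rightarrow> bool" where
  "onb V B \<longleftrightarrow> span B = V \<and> pairwise orthogonal B \<and> (\<forall>b\<in>B. norm b = 1)"

definition subspace_lborel :: "(real ^ 'n) set \<Rightarrow> (real ^ 'n) measure" where
  "subspace_lborel V =
     (let B = (SOME B. onb V B)
      in distr (\<Pi>\<^sub>M b\<in>B. (lborel :: real measure)) borel (\<lambda>c. \<Sum>b\<in>B. c b *\<^sub>R b))"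

definition val ::
  "('i \<Rightarrow> real ^ 'n) \<Rightarrow> 'i set \<Rightarrow> (real ^ 'n \<Rightarrow> real) \<Rightarrow> real \<Rightarrow> real ^ 'n \<Rightarrow> nat" where
  "val \<psi> I nrm \<tau> d =
     (LEAST n. \<exists>c :: 'i \<Rightarrow> real. n = card {i \<in> I. c i \<noteq> 0} \<and> nrm ((\<Sum>i\<in>I. c i *\<^sub>R \<psi> i) - d) \<le> \<tau>)"

definition T :: "('i \<Rightarrow> real ^ 'n) \<Rightarrow> 'i set \<Rightarrow> (real ^ 'n) set" where
  "T \<psi> J = span (\<psi> ` J)"

definition Tt ::
  "('i \<Rightarrow> real ^ 'n) \<Rightarrow> (real ^ 'n \<Rightarrow> real) \<Rightarrow> real \<Rightarrow> 'i set \<Rightarrow> (real ^ 'n) set" where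
  "Tt \<psi> nrm \<tau> J = {x + y | x y. x \<in> T \<psi> J \<and> y \<in> proj ((T \<psi> J)\<^sup>\<bottom>) ` lev nrm \<tau>}"

definition h :: "('i \<Rightarrow> real ^ 'n) \<Rightarrow> (real ^ 'n \<Rightarrow> real) \<Rightarrow> 'i set \<Rightarrow> real ^ 'n \<Rightarrow> real" where
  "h \<psi> nrm J u = Inf {t. 0 < t \<and> (1 / t) *\<^sub>R u \<in> proj ((T \<psi> J)\<^sup>\<bottom>) ` lev nrm 1}"

definition C ::
  "('i \<Rightarrow> real ^ 'n) \<Rightarrow> (real ^ 'n \<Rightarrow> real) \<Rightarrow> (real ^ 'n \<Rightarrow> real) \<Rightarrow> 'i set \<Rightarrow> real" where
  "C \<psi> nrm fd J =
     measure (subspace_lborel ((T \<psi> J)\<^sup>\<bottom>)) (proj ((T \<psi> J)\<^sup>\<bottom>) ` lev nrm 1) *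
     measure (subspace_lborel (T \<psi> J)) (T \<psi> J \<inter> lev fd 1)"

definition Q ::
  "('i \<Rightarrow> real ^ 'n) \<Rightarrow> (real ^ 'n \<Rightarrow> real) \<Rightarrow> real \<Rightarrow> 'i set \<Rightarrow> 'i set \<Rightarrow> real" where
  "Q \<psi> fd \<delta>\<^sub>2 J\<^sub>1 J\<^sub>2 =
     (let W = T \<psi> J\<^sub>1 \<inter> T \<psi> J\<^sub>2
      in measure (subspace_lborel (W\<^sup>\<bottom>)) (W\<^sup>\<bottom> \<inter> lev norm (2 * \<delta>\<^sub>2)) *
         measure (subspace_lborel W) (W \<inter> lev fd 1))"

definition H ::
  "('i \<Rightarrow> real ^ 'n) \<Rightarrow> (nat \<Rightarrow> 'i set set) \<Rightarrow> nat \<Rightarrow> nat \<Rightarrow> ('i set \<times> 'i set) set" where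
  "H \<psi> \<J> K k = {(J\<^sub>1, J\<^sub>2). J\<^sub>1 \<in> \<J> K \<and> J\<^sub>2 \<in> \<J> K \<and> dim (T \<psi> J\<^sub>1 \<inter> T \<psi> J\<^sub>2) = k}"

text \<open>
  In the following, \<open>\<delta> J\<close> is the constant \<open>\<delta>\<^sub>J\<close> attached to a subset of the dictionary and
  \<open>\<eta> J\<^sub>1 J\<^sub>2\<close> the one attached to a pair of subsets.
\<close>

definition \<delta>_hat :: "(nat \<Rightarrow> 'i set set) \<Rightarrow> ('i set \<Rightarrow> real) \<Rightarrow> nat \<Rightarrow> real" where
  "\<delta>_hat \<J> \<delta> K = Max (\<delta> ` \<J> K)"

definition C_bar ::
  "('i \<Rightarrow> real ^ 'n) \<Rightarrow> (real ^ 'n \<Rightarrow> real) \<Rightarrow> (real ^ 'n \<Rightarrow> real) \<Rightarrow> (nat \<Rightarrow> 'i set set) \<Rightarrow> nat \<Rightarrow> real"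
  where "C_bar \<psi> nrm fd \<J> K = (\<Sum>J\<in>\<J> K. C \<psi> nrm fd J)"

definition \<eta>_hat ::
  "('i \<Rightarrow> real ^ 'n) \<Rightarrow> (nat \<Rightarrow> 'i set set) \<Rightarrow> ('i set \<Rightarrow> 'i set \<Rightarrow> real) \<Rightarrow> nat \<Rightarrow> nat \<Rightarrow> real" where
  "\<eta>_hat \<psi> \<J> \<eta> K k = Max (insert 0 ((\<lambda>(J\<^sub>1, J\<^sub>2). \<eta> J\<^sub>1 J\<^sub>2) ` H \<psi> \<J> K k))"

definition Q_bar ::
  "('i \<Rightarrow> real ^ 'n) \<Rightarrow> (real ^ 'n \<Rightarrow> real) \<Rightarrow> real \<Rightarrow> (nat \<Rightarrow> 'i set set) \<Rightarrow> nat \<Rightarrow> nat \<Rightarrow> real" where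
  "Q_bar \<psi> fd \<delta>\<^sub>2 \<J> K k = (\<Sum>(J\<^sub>1, J\<^sub>2)\<in>H \<psi> \<J> K k. Q \<psi> fd \<delta>\<^sub>2 J\<^sub>1 J\<^sub>2)"

text \<open>
  In the index ranges below, \<open>2 * K - CARD('n)\<close> is truncated subtraction on \<open>nat\<close>, hence
  equal to \<open>max 0 (2K - N)\<close>.
\<close>

fun \<Delta> ::
  "('i \<Rightarrow> real ^ 'n) \<Rightarrow> (nat \<Rightarrow> 'i set set) \<Rightarrow> ('i set \<Rightarrow> real) \<Rightarrow> ('i set \<Rightarrow> 'i set \<Rightarrow> real) \<Rightarrow> nat \<Rightarrow> real"
  where
    "\<Delta> \<psi> \<J> \<delta> \<eta> 0 = \<delta>_hat \<J> \<delta> 0"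
  | "\<Delta> (\<psi> :: 'i \<Rightarrow> real ^ 'n) \<J> \<delta> \<eta> (Suc m) =
       (let K = Suc m in
        if K < CARD('n)
        then Max ({\<Delta> \<psi> \<J> \<delta> \<eta> m, \<delta>_hat \<J> \<delta> K} \<union> \<eta>_hat \<psi> \<J> \<eta> K ` {2 * K - CARD('n)..<K})
        else max (\<Delta> \<psi> \<J> \<delta> \<eta> m) (\<delta>_hat \<J> \<delta> K))"

text \<open>
  The error terms depend on \<open>\<tau>\<close> and \<open>\<theta>\<close> only through \<open>r = \<tau> / \<theta>\<close>. Terms of index \<open>-1\<close> are zero,
  which is the case \<open>K = 0\<close> in the case distinctions.
\<close>

definition eps0 ::
  "('i \<Rightarrow> real ^ 'n) \<Rightarrow> (real ^ 'n \<Rightarrow> real) \<Rightarrow> real \<Rightarrow> (nat \<Rightarrow> 'i set set) \<Rightarrow> ('i set \<Rightarrow> 'i set \<Rightarrow> real) \<Rightarrow>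
   nat \<Rightarrow> real \<Rightarrow> real" where
  "eps0 \<psi> fd \<delta>\<^sub>2 \<J> \<eta> K r =
     (if 0 < K \<and> K < CARD('n)
      then \<Sum>k\<in>{2 * K - CARD('n)..<K}.
             Q_bar \<psi> fd \<delta>\<^sub>2 \<J> K k * r ^ (CARD('n) - k) * (1 + \<eta>_hat \<psi> \<J> \<eta> K k * r) ^ k
      else 0)"

definition eps0' ::
  "('i \<Rightarrow> real ^ 'n) \<Rightarrow> (real ^ 'n \<Rightarrow> real) \<Rightarrow> (real ^ 'n \<Rightarrow> real) \<Rightarrow> real \<Rightarrow> (nat \<Rightarrow> 'i set set) \<Rightarrow>
   ('i set \<Rightarrow> real) \<Rightarrow> ('i set \<Rightarrow> 'i set \<Rightarrow> real) \<Rightarrow> nat \<Rightarrow> real \<Rightarrow> real" where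
  "eps0' \<psi> nrm fd \<delta>\<^sub>2 \<J> \<delta> \<eta> K r =
     eps0 \<psi> fd \<delta>\<^sub>2 \<J> \<eta> K r +
     (case K of
        0 \<Rightarrow> 0
      | Suc m \<Rightarrow> C_bar \<psi> nrm fd \<J> m * r ^ (CARD('n) - m) * (1 + \<delta>_hat \<J> \<delta> m * r) ^ m)"

definition eps1 ::
  "('i \<Rightarrow> real ^ 'n) \<Rightarrow> (real ^ 'n \<Rightarrow> real) \<Rightarrow> (real ^ 'n \<Rightarrow> real) \<Rightarrow> real \<Rightarrow> (nat \<Rightarrow> 'i set set) \<Rightarrow>
   ('i set \<Rightarrow> real) \<Rightarrow> ('i set \<Rightarrow> 'i set \<Rightarrow> real) \<Rightarrow> nat \<Rightarrow> real \<Rightarrow> real" where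
  "eps1 \<psi> nrm fd \<delta>\<^sub>2 \<J> \<delta> \<eta> K r =
     (case K of
        0 \<Rightarrow> 0
      | Suc m \<Rightarrow> eps0 \<psi> fd \<delta>\<^sub>2 \<J> \<eta> m r -
          C_bar \<psi> nrm fd \<J> m * r ^ (CARD('n) - m) * (1 - \<delta>_hat \<J> \<delta> m * r) ^ m)"

definition uniform_rv :: "'w measure \<Rightarrow> ('w \<Rightarrow> real ^ 'n) \<Rightarrow> (real ^ 'n) set \<Rightarrow> bool" where
  "uniform_rv M d A \<longleftrightarrow>
     prob_space M \<and> d \<in> borel_measurable M \<and> distr M borel d = uniform_measure lborel A"

definition ratio_to_0 :: "(real \<times> real) filter" where
  "ratio_to_0 =
     inf (filtercomap (\<lambda>(\<tau>, \<theta>). \<tau> / \<theta>) (nhds 0)) (principal {(\<tau>, \<theta>). 0 < \<tau> \<and> 0 < \<theta>})"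

end

theory Submission
  imports Defs
begin

text \<open>
  Every dictionary subset spanning a subspace of dimension at most \<open>L\<close> extends to one spanning
  dimension exactly \<open>L\<close>, so \<open>{val \<le> L}\<close> is the union of the slabs \<open>Tt \<psi> nrm \<tau> J\<close> over
  \<open>J \<in> \<J> L\<close>. Slicing a slab parallel to its subspace \<open>T \<psi> J\<close> (Fubini in an adapted orthonormal
  basis), each slice of the slab intersected with \<open>lev fd \<theta>\<close> lies between the \<open>fd\<close>-balls of
  radius \<open>\<theta> \<plusminus> \<delta> J * \<tau>\<close> in \<open>T \<psi> J\<close>, which bounds its volume on both sides. The
  Bonferroni inequalities then bound the volume of the union, pairwise intersections being
  controlled by the constants \<open>\<eta>\<close>; the event \<open>val = K\<close> is the difference of the events for \<open>K\<close>
  and \<open>K - 1\<close>.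
\<close>

section \<open>Lebesgue measure in orthonormal coordinates\<close>

text \<open>Two distinct spans of dimension K meet in some dimension k < K, so the overlap of their
  slabs is bounded by order \<open>r ^ (N - k)\<close> with r = \<tau> / \<theta>, below the main
  order \<open>r ^ (N - K)\<close>; this makes the Bonferroni loss an error term. Only lower bounds
  for a union carry it, since the upper bound is plain subadditivity. In the difference, a lower
  bound at K is paired with an upper bound at K - 1, which produces \<open>eps0'\<close>, and an
  upper bound at K with a lower bound at K - 1, which produces \<open>eps1\<close>. The constants
  \<open>\<Delta>\<close> dominate every \<delta> and \<eta> involved: the threshold on \<theta>
  keeps the radii \<theta> - \<delta> * \<tau> nonnegative and makes the pair bounds applicable.
  They are also positive, whence \<theta> > 0. The measure on a subspace is defined through an
  unspecified orthonormal basis, so slicing along V and its complement first requires that Lebesgue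
  measure is the product measure in every orthonormal basis; this is why rotation invariance comes
  first.\<close>

lemma nn_integral_lborel_translate:
  fixes c :: "'a::euclidean_space"
  assumes [measurable]: "g \<in> borel_measurable borel"
  shows "(\<integral>\<^sup>+x. g (x + c) \<partial>lborel) = (\<integral>\<^sup>+x. g x \<partial>lborel)"
proof -
  have "(\<integral>\<^sup>+x. g x \<partial>lborel) = (\<integral>\<^sup>+x. g x \<partial>distr lborel borel ((+) c))"
    by (simp only: lborel_distr_plus)
  also have "\<dots> = (\<integral>\<^sup>+x. g (c + x) \<partial>lborel)"
    by (subst nn_integral_distr) auto
  finally show ?thesis
    by (simp add: add.commute)
qed

text \<open>
  The library's \<open>measure_orthogonal_image\<close> needs a well-ordered index type. Here both translation
  invariant measures are compared on \<open>A \<times> ball 0 1\<close> by two applications of Fubini's theorem; they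
  agree on the unit ball.
\<close>

lemma distr_lborel_orthogonal_transformation:
  fixes f :: "'a::euclidean_space \<Rightarrow> 'a"
  assumes f: "orthogonal_transformation f"
  shows "distr lborel borel f = lborel"
proof (rule measure_eqI)
  fix A assume "A \<in> sets (distr lborel borel f)"
  then have A[measurable]: "A \<in> sets borel"
    by simp
  have "linear f"
    using f by (simp add: orthogonal_transformation_linear)
  then have fm[measurable]: "f \<in> borel_measurable borel"
    by (simp add: borel_measurable_continuous_onI linear_continuous_on linear_conv_bounded_linear)
  obtain g where g: "\<And>x. f (g x) = x"
    using orthogonal_transformation_surj[OF f] by (metis surjD)
  let ?B = "ball 0 1 :: 'a set"
  have [measurable]: "A \<in> sets lborel" "?B \<in> sets borel" "?B \<in> sets lborel"
    "f \<in> borel_measurable lborel"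
    using A fm by simp_all
  have B: "emeasure lborel ?B \<noteq> 0" "emeasure lborel ?B \<noteq> \<infinity>"
    using emeasure_lborel_ball_finite[of "0::'a" 1] content_ball_pos[of 1 "0::'a"]
    by (auto simp: measure_def)
  have "emeasure lborel A * emeasure lborel ?B
      = (\<integral>\<^sup>+y. \<integral>\<^sup>+x. indicator ?B (f y) * indicator A x \<partial>lborel \<partial>lborel)"
  proof -
    have "indicator ?B (f y) = (indicator ?B y :: ennreal)" for y
      using f by (simp add: indicator_def orthogonal_transformation_norm)
    then have "(\<integral>\<^sup>+y. \<integral>\<^sup>+x. indicator ?B (f y) * indicator A x \<partial>lborel \<partial>lborel)
        = (\<integral>\<^sup>+y. emeasure lborel A * indicator ?B y \<partial>lborel)"
      by (simp add: nn_integral_cmult nn_integral_multc mult.commute)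
    also have "\<dots> = emeasure lborel A * emeasure lborel ?B"
      by (subst nn_integral_cmult) (auto intro!: borel_measurable_indicator)
    finally show ?thesis ..
  qed
  also have "\<dots> = (\<integral>\<^sup>+y. \<integral>\<^sup>+x. indicator ?B (f y) * indicator A (x + f y) \<partial>lborel \<partial>lborel)"
    by (subst nn_integral_lborel_translate) auto
  also have "\<dots> = (\<integral>\<^sup>+x. \<integral>\<^sup>+y. indicator ?B (f y) * indicator A (x + f y) \<partial>lborel \<partial>lborel)"
    by (rule lborel_pair.Fubini') measurable
  also have "\<dots> = (\<integral>\<^sup>+x. \<integral>\<^sup>+y. indicator ?B (f y - x) * indicator A (f y) \<partial>lborel \<partial>lborel)"
  proof (rule nn_integral_cong)
    \<comment> \<open>\<open>g x\<close> is a preimage of \<open>x\<close> under \<open>f\<close>,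
      so translating \<open>y\<close> by \<open>g x\<close> shifts \<open>f y\<close> by exactly
      \<open>x\<close>.\<close>
    fix x
    have "f (y + g x) - x = f y" "f (y + g x) = x + f y" for y
      using \<open>linear f\<close> by (auto simp: linear_add g)
    then show "(\<integral>\<^sup>+y. indicator ?B (f y) * indicator A (x + f y) \<partial>lborel)
        = (\<integral>\<^sup>+y. indicator ?B (f y - x) * indicator A (f y) \<partial>lborel)"
      using nn_integral_lborel_translate[of "\<lambda>y. indicator ?B (f y - x) * indicator A (f y)" "g x"]
      by simp
  qed
  also have "\<dots> = (\<integral>\<^sup>+y. \<integral>\<^sup>+x. indicator ?B (f y - x) * indicator A (f y) \<partial>lborel \<partial>lborel)"
    by (rule lborel_pair.Fubini') measurable
  also have "\<dots> = (\<integral>\<^sup>+y. emeasure lborel ?B * indicator A (f y) \<partial>lborel)"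
  proof (rule nn_integral_cong)
    fix y
    have "(\<integral>\<^sup>+x. indicator ?B (f y - x) \<partial>lborel) = (\<integral>\<^sup>+x. indicator ?B (x - f y) \<partial>lborel)"
      by (intro nn_integral_cong) (simp add: indicator_def norm_minus_commute)
    also have "\<dots> = (\<integral>\<^sup>+x. indicator ?B x \<partial>lborel)"
      using nn_integral_lborel_translate[of "indicator ?B" "- f y"] by simp
    finally show "(\<integral>\<^sup>+x. indicator ?B (f y - x) * indicator A (f y) \<partial>lborel)
        = emeasure lborel ?B * indicator A (f y)"
      by (simp add: nn_integral_multc)
  qed
  also have "\<dots> = emeasure lborel ?B * (\<integral>\<^sup>+y. indicator A (f y) \<partial>lborel)"
    by (simp add: nn_integral_cmult)
  also have "(\<integral>\<^sup>+y. indicator A (f y) \<partial>lborel) = (\<integral>\<^sup>+y. indicator A y \<partial>distr lborel borel f)"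
    by (subst nn_integral_distr) auto
  finally have "emeasure lborel ?B * emeasure lborel A
      = emeasure lborel ?B * emeasure (distr lborel borel f) A"
    by (simp add: mult.commute)
  then show "emeasure (distr lborel borel f) A = emeasure lborel A"
    using B by (simp add: ennreal_mult_cancel_left)
qed simp

section \<open>Orthonormal bases and the measure they induce on a subspace\<close>

lemma onb_exists: "subspace V \<Longrightarrow> \<exists>B. onb V B"
  by (rule orthonormal_basis_subspace[of V]) (auto simp: onb_def)

context
  fixes V B :: "(real ^ 'n) set"
  assumes onb: "onb V B"
begin

lemma onb_independent: "independent B"
  using onb by (intro pairwise_orthogonal_independent) (auto simp: onb_def)

lemma onb_finite: "finite B"
  using onb_independent by (rule independent_imp_finite)

lemma onb_card: "card B = dim V"
  using onb onb_independent by (metis dim_span dim_eq_card_independent onb_def)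

lemma onb_inner: "b \<in> B \<Longrightarrow> b' \<in> B \<Longrightarrow> b \<bullet> b' = (if b = b' then 1 else 0)"
  using onb by (auto simp: onb_def pairwise_def orthogonal_def dot_square_norm)

lemma onb_sum_inner: "b \<in> B \<Longrightarrow> (\<Sum>b'\<in>B. c b' *\<^sub>R b') \<bullet> b = c b"
  by (simp add: inner_sum_left onb_inner onb_finite if_distrib cong: if_cong)

lemma onb_sum_mem: "(\<Sum>b\<in>B. c b *\<^sub>R b) \<in> V"
  using onb by (auto simp: onb_def intro: span_sum span_scale span_base)

lemma onb_representation:
  assumes "x \<in> V"
  shows "(\<Sum>b\<in>B. (x \<bullet> b) *\<^sub>R b) = x"
proof -
  have "x \<in> span B"
    using assms onb by (simp add: onb_def)
  then obtain c where x: "x = (\<Sum>b\<in>B. c b *\<^sub>R b)"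
    using onb_finite by (auto simp: span_finite)
  show ?thesis
    by (simp add: x onb_sum_inner cong: sum.cong)
qed

end

interpretation lborel_product: product_sigma_finite "\<lambda>_::'a. lborel :: real measure"
  by standard

text \<open>An orthogonal map \<open>f\<close> sending the standard basis to \<open>B\<close> turns
  coordinates in \<open>B\<close> into standard coordinates. By rotation invariance the coordinate
  vector in \<open>B\<close> therefore has the law of the standard one, which is checked on
  boxes.\<close>

lemma distr_PiM_onb_UNIV:
  fixes B :: "(real ^ 'n) set"
  assumes B: "onb UNIV B"
  shows "distr (\<Pi>\<^sub>M b\<in>B. lborel) borel (\<lambda>c. \<Sum>b\<in>B. c b *\<^sub>R b) = lborel"
proof -
  note fin = onb_finite[OF B] and inner = onb_inner[OF B]
  have "card (Basis :: (real ^ 'n) set) = card B"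
    using onb_card[OF B] by simp
  then obtain g where g: "bij_betw g (Basis :: (real ^ 'n) set) B"
    using fin by (metis bij_betw_iff_card finite_Basis)
  define f where "f x = (\<Sum>i\<in>Basis. (x \<bullet> i) *\<^sub>R g i)" for x :: "real ^ 'n"
  have gB: "g i \<in> B" if "i \<in> Basis" for i
    using g that by (auto simp: bij_betw_def)
  have f_inner: "f x \<bullet> g i = x \<bullet> i" if "i \<in> Basis" for x i
  proof -
    have "f x \<bullet> g i = (\<Sum>j\<in>Basis. (x \<bullet> j) * (if j = i then 1 else 0))"
      using g that gB unfolding f_def inner_sum_left
      by (intro sum.cong) (auto simp: inner bij_betw_def inj_on_def)
    then show ?thesis
      using that by (simp add: if_distrib cong: if_cong)
  qed
  have "linear f"
    unfolding f_def by (intro linear_compose_sum ballI linearI) (auto simp: algebra_simps)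
  moreover have "f x \<bullet> f y = x \<bullet> y" for x y
  proof -
    have "f x \<bullet> f y = (\<Sum>i\<in>Basis. (y \<bullet> i) * (f x \<bullet> g i))"
      by (simp add: f_def[of y] inner_sum_right)
    also have "\<dots> = x \<bullet> y"
      by (subst euclidean_inner) (auto simp: f_inner mult.commute intro: sum.cong)
    finally show ?thesis .
  qed
  ultimately have f: "orthogonal_transformation f"
    by (simp add: orthogonal_transformation_def)
  have fm[measurable]: "f \<in> borel_measurable borel"
    unfolding f_def by measurable
  let ?coord = "\<lambda>x. \<lambda>b\<in>B. x \<bullet> b"
  have coord[measurable]: "?coord \<in> measurable borel (\<Pi>\<^sub>M b\<in>B. lborel)"
    by (intro measurable_restrict) auto
  have "distr lborel (\<Pi>\<^sub>M b\<in>B. lborel) ?coord = (\<Pi>\<^sub>M b\<in>B. lborel)"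
  proof (rule lborel_product.PiM_eqI[OF fin])
    fix A :: "_ \<Rightarrow> real set" assume A: "\<And>b. b \<in> B \<Longrightarrow> A b \<in> sets lborel"
    have PiE: "Pi\<^sub>E B A \<in> sets (\<Pi>\<^sub>M b\<in>B. lborel)"
      using A fin by (intro sets_PiM_I_finite) auto
    have "emeasure (distr lborel (\<Pi>\<^sub>M b\<in>B. lborel) ?coord) (Pi\<^sub>E B A)
        = emeasure (distr lborel borel f) (?coord -` Pi\<^sub>E B A)"
      using PiE measurable_sets[OF coord PiE]
      by (subst distr_lborel_orthogonal_transformation[OF f])
        (simp add: emeasure_distr)
    also have "\<dots> = emeasure lborel (f -` ?coord -` Pi\<^sub>E B A)"
      using measurable_sets[OF coord PiE] by (simp add: emeasure_distr)
    also have "f -` ?coord -` Pi\<^sub>E B A = {x. \<forall>i\<in>Basis. x \<bullet> i \<in> A (g i)}"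
      using g by (auto simp: PiE_iff f_inner bij_betw_def)
    also have "emeasure lborel \<dots>
        = emeasure (\<Pi>\<^sub>M b\<in>Basis. lborel) (Pi\<^sub>E (Basis :: (real ^ 'n) set) (\<lambda>i. A (g i)))"
    proof -
      have [measurable]: "A (g i) \<in> sets borel" if "i \<in> Basis" for i
        using A[OF gB[OF that]] by simp
      have "{x :: real ^ 'n. \<forall>i\<in>Basis. x \<bullet> i \<in> A (g i)} \<in> sets borel"
        by measurable
      then show ?thesis
        by (subst lborel_eq, subst emeasure_distr)
          (auto intro!: arg_cong[where f = "emeasure _"]
            simp: space_PiM PiE_iff inner_sum_left inner_Basis if_distrib cong: if_cong)
    qed
    also have "\<dots> = (\<Prod>i\<in>Basis. emeasure lborel (A (g i)))"
      using A gB by (intro lborel_product.emeasure_PiM) auto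
    also have "\<dots> = (\<Prod>b\<in>B. emeasure lborel (A b))"
      using g by (rule prod.reindex_bij_betw)
    finally show "emeasure (distr lborel (\<Pi>\<^sub>M b\<in>B. lborel) ?coord) (Pi\<^sub>E B A)
        = (\<Prod>b\<in>B. emeasure lborel (A b))" .
  qed simp
  then have "distr (\<Pi>\<^sub>M b\<in>B. lborel) borel (\<lambda>c. \<Sum>b\<in>B. c b *\<^sub>R b)
      = distr (distr lborel (\<Pi>\<^sub>M b\<in>B. lborel) ?coord) borel (\<lambda>c. \<Sum>b\<in>B. c b *\<^sub>R b)"
    by simp
  also have "\<dots> = distr lborel borel (\<lambda>x. x)"
    using onb_representation[OF B]
    by (subst distr_distr) (auto intro!: distr_cong simp: comp_def)
  also have "\<dots> = lborel"
    by (simp add: distr_id2)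
  finally show ?thesis .
qed

text \<open>Nothing is known about the basis picked by \<open>SOME\<close> except that it is
  orthonormal; later arguments about the values of the measure enter through this form.\<close>

lemma subspace_lborel_onb:
  assumes "subspace V"
  obtains B where "onb V B"
    "subspace_lborel V = distr (\<Pi>\<^sub>M b\<in>B. lborel) borel (\<lambda>c. \<Sum>b\<in>B. c b *\<^sub>R b)"
  using that someI_ex[OF onb_exists[OF assms]] unfolding subspace_lborel_def Let_def by blast

lemma sets_subspace_lborel [simp]: "sets (subspace_lborel V) = sets borel"
  by (simp add: subspace_lborel_def Let_def)

lemma space_subspace_lborel [simp]: "space (subspace_lborel V) = UNIV"
  by (simp add: subspace_lborel_def Let_def)

text \<open>The measure lives on the whole ambient space but is concentrated on \<open>V\<close>,
  because the map from coordinates to vectors takes values in \<open>V\<close>.\<close>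

lemma emeasure_subspace_lborel_Int:
  assumes V: "subspace V" and X: "X \<in> sets borel"
  shows "emeasure (subspace_lborel V) X = emeasure (subspace_lborel V) (V \<inter> X)"
proof -
  obtain B where B: "onb V B"
    "subspace_lborel V = distr (\<Pi>\<^sub>M b\<in>B. lborel) borel (\<lambda>c. \<Sum>b\<in>B. c b *\<^sub>R b)"
    using subspace_lborel_onb[OF V] .
  have "V \<inter> X \<in> sets borel"
    using X closed_subspace[OF V] by auto
  then show ?thesis
    using X onb_sum_mem[OF B(1)] unfolding B(2)
    by (simp add: emeasure_distr vimage_Int Int_assoc) (auto intro!: arg_cong[where f = "emeasure _"])
qed

text \<open>By Cauchy-Schwarz the coordinates of points of norm at most \<open>R\<close> lie in a
  cube of finite product measure. A non-measurable \<open>X\<close> has \<open>emeasure\<close> 0 by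
  convention.\<close>

lemma emeasure_subspace_lborel_finite:
  assumes V: "subspace V" and X: "bounded X"
  shows "emeasure (subspace_lborel V) X < \<infinity>"
proof (cases "X \<in> sets borel")
  case True
  obtain B where B: "onb V B"
    "subspace_lborel V = distr (\<Pi>\<^sub>M b\<in>B. lborel) borel (\<lambda>c. \<Sum>b\<in>B. c b *\<^sub>R b)"
    using subspace_lborel_onb[OF V] .
  note fin = onb_finite[OF B(1)]
  obtain R where R: "\<And>x. x \<in> X \<Longrightarrow> norm x \<le> R" "0 < R"
    using X by (auto simp: bounded_pos)
  let ?M = "\<Pi>\<^sub>M b\<in>B. lborel :: real measure"
  have *: "\<bar>c b\<bar> \<le> R" if "(\<Sum>b\<in>B. c b *\<^sub>R b) \<in> X" "b \<in> B" for c b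
  proof -
    have "\<bar>c b\<bar> = \<bar>(\<Sum>b\<in>B. c b *\<^sub>R b) \<bullet> b\<bar>"
      using onb_sum_inner[OF B(1) that(2)] by simp
    also have "\<dots> \<le> norm (\<Sum>b\<in>B. c b *\<^sub>R b) * norm b"
      by (rule Cauchy_Schwarz_ineq2)
    also have "\<dots> \<le> R"
      using B(1) that R(1)[OF that(1)] by (auto simp: onb_def)
    finally show ?thesis .
  qed
  have "emeasure (subspace_lborel V) X
      = emeasure ?M ((\<lambda>c. \<Sum>b\<in>B. c b *\<^sub>R b) -` X \<inter> space ?M)"
    using True unfolding B(2) by (subst emeasure_distr) auto
  also have "\<dots> \<le> emeasure ?M (Pi\<^sub>E B (\<lambda>_. {-R..R}))"
  proof (rule emeasure_mono)
    show "(\<lambda>c. \<Sum>b\<in>B. c b *\<^sub>R b) -` X \<inter> space ?M \<subseteq> Pi\<^sub>E B (\<lambda>_. {-R..R})"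
    proof
      fix c assume "c \<in> (\<lambda>c. \<Sum>b\<in>B. c b *\<^sub>R b) -` X \<inter> space ?M"
      then show "c \<in> Pi\<^sub>E B (\<lambda>_. {-R..R})"
        using *[of c] by (auto simp: space_PiM PiE_iff abs_le_iff minus_le_iff)
    qed
    show "Pi\<^sub>E B (\<lambda>_. {-R..R}) \<in> sets ?M"
      using fin by (intro sets_PiM_I_finite) auto
  qed
  also have "\<dots> = (\<Prod>b\<in>B. emeasure lborel {-R..R})"
    using fin by (intro lborel_product.emeasure_PiM) auto
  also have "\<dots> < \<infinity>"
    using R by (simp add: ennreal_power[symmetric] power_less_top_ennreal)
  finally show ?thesis .
qed (simp add: emeasure_notin_sets)

lemma emeasure_subspace_lborel_scale:
  assumes V: "subspace V" and X: "X \<in> sets borel" and c: "0 < c"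
  shows "emeasure (subspace_lborel V) ((*\<^sub>R) c ` X)
    = ennreal (c ^ dim V) * emeasure (subspace_lborel V) X"
proof -
  obtain B where B: "onb V B"
    "subspace_lborel V = distr (\<Pi>\<^sub>M b\<in>B. lborel) borel (\<lambda>c. \<Sum>b\<in>B. c b *\<^sub>R b)"
    using subspace_lborel_onb[OF V] .
  note fin = onb_finite[OF B(1)]
  let ?M = "\<Pi>\<^sub>M b\<in>B. lborel :: real measure" and ?s = "\<lambda>a. \<lambda>b\<in>B. c * a b"
  have s[measurable]: "?s \<in> measurable ?M ?M"
    by (intro measurable_restrict) auto
  \<comment> \<open>The one-dimensional Jacobian \<open>c\<close> occurs once per coordinate; with
    \<open>card B = dim V\<close> factors this compensates the dilation of the coordinates.\<close>
  have M: "density (distr ?M ?M ?s) (\<lambda>_. ennreal (c ^ dim V)) = ?M"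
  proof (rule lborel_product.PiM_eqI[OF fin])
    fix A :: "_ \<Rightarrow> real set" assume A: "\<And>b. b \<in> B \<Longrightarrow> A b \<in> sets lborel"
    have PiE: "Pi\<^sub>E B A \<in> sets ?M"
      using A fin by (intro sets_PiM_I_finite) auto
    have A': "(*) c -` A b \<in> sets borel" if "b \<in> B" for b
      using A[OF that] measurable_sets[of "(*) c" borel borel "A b"] by simp
    have "emeasure (density (distr ?M ?M ?s) (\<lambda>_. ennreal (c ^ dim V))) (Pi\<^sub>E B A)
        = ennreal (c ^ dim V) * emeasure ?M (?s -` Pi\<^sub>E B A \<inter> space ?M)"
      using PiE by (simp add: emeasure_density nn_integral_cmult emeasure_distr)
    also have "?s -` Pi\<^sub>E B A \<inter> space ?M = Pi\<^sub>E B (\<lambda>b. (*) c -` A b)"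
      by (auto simp: space_PiM PiE_iff)
    also have "emeasure ?M \<dots> = (\<Prod>b\<in>B. emeasure lborel ((*) c -` A b))"
      using fin A' by (intro lborel_product.emeasure_PiM) auto
    also have "ennreal (c ^ dim V) * \<dots> = (\<Prod>b\<in>B. ennreal c * emeasure lborel ((*) c -` A b))"
      using c by (simp add: prod.distrib onb_card[OF B(1)] ennreal_power)
    also have "\<dots> = (\<Prod>b\<in>B. emeasure lborel (A b))"
    proof (intro prod.cong refl)
      fix b assume "b \<in> B"
      then have [measurable]: "A b \<in> sets borel"
        using A by simp
      have "emeasure lborel (A b) = emeasure (density (distr lborel borel ((*) c)) (\<lambda>_. ennreal \<bar>c\<bar>)) (A b)"
        using c lborel_distr_mult'[of c] by simp
      also have "\<dots> = ennreal c * emeasure lborel ((*) c -` A b)"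
        using c by (simp add: emeasure_density nn_integral_cmult emeasure_distr)
      finally show "ennreal c * emeasure lborel ((*) c -` A b) = emeasure lborel (A b)"
        by simp
    qed
    finally show "emeasure (density (distr ?M ?M ?s) (\<lambda>_. ennreal (c ^ dim V))) (Pi\<^sub>E B A)
        = (\<Prod>b\<in>B. emeasure lborel (A b))" .
  qed simp
  let ?f = "\<lambda>a. \<Sum>b\<in>B. a b *\<^sub>R b"
  have f[measurable]: "?f \<in> borel_measurable ?M"
    by measurable
  have sc: "(*\<^sub>R) c ` X = (\<lambda>x. (1 / c) *\<^sub>R x) -` X"
    using c by (force simp: image_iff)
  have cX[measurable]: "(*\<^sub>R) c ` X \<in> sets borel"
    unfolding sc using X measurable_sets[of "\<lambda>x. (1 / c) *\<^sub>R x" borel borel X] by simp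
  have "emeasure (subspace_lborel V) ((*\<^sub>R) c ` X)
      = emeasure (density (distr ?M ?M ?s) (\<lambda>_. ennreal (c ^ dim V))) (?f -` ((*\<^sub>R) c ` X) \<inter> space ?M)"
    unfolding M B(2) by (rule emeasure_distr) auto
  also have "\<dots> = ennreal (c ^ dim V) * emeasure ?M (?s -` (?f -` ((*\<^sub>R) c ` X) \<inter> space ?M) \<inter> space ?M)"
  proof -
    have "?f -` ((*\<^sub>R) c ` X) \<inter> space ?M \<in> sets ?M"
      using f cX by (rule measurable_sets)
    then show ?thesis
      by (simp add: emeasure_density nn_integral_cmult emeasure_distr)
  qed
  also have "?s -` (?f -` ((*\<^sub>R) c ` X) \<inter> space ?M) \<inter> space ?M = ?f -` X \<inter> space ?M"
  proof -
    have "?f (?s a) = c *\<^sub>R ?f a" for a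
      by (simp add: scaleR_sum_right)
    then show ?thesis
      using c by (auto simp: space_PiM)
  qed
  also have "emeasure ?M \<dots> = emeasure (subspace_lborel V) X"
    unfolding B(2) using X by (simp add: emeasure_distr)
  finally show ?thesis .
qed

text \<open>Cavalieri's principle: \<open>u\<close> is the offset orthogonal to \<open>V\<close>,
  and the inner measure is that of the slice parallel to \<open>V\<close>. Orthonormal bases of
  \<open>V\<close> and of its complement unite to one of the whole space, over which the product
  measure splits into two factors.\<close>

lemma emeasure_lborel_orthogonal_decomp:
  assumes V: "subspace V" and S[measurable]: "S \<in> sets borel"
  shows "emeasure lborel S
    = (\<integral>\<^sup>+u. emeasure (subspace_lborel V) {v. u + v \<in> S} \<partial>subspace_lborel (V\<^sup>\<bottom>))"
proof -
  obtain B where B: "onb V B"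
    "subspace_lborel V = distr (\<Pi>\<^sub>M b\<in>B. lborel) borel (\<lambda>c. \<Sum>b\<in>B. c b *\<^sub>R b)"
    using subspace_lborel_onb[OF V] .
  obtain B' where B': "onb (V\<^sup>\<bottom>) B'"
    "subspace_lborel (V\<^sup>\<bottom>) = distr (\<Pi>\<^sub>M b\<in>B'. lborel) borel (\<lambda>c. \<Sum>b\<in>B'. c b *\<^sub>R b)"
    using subspace_lborel_onb[OF subspace_orthogonal_comp] .
  have orth: "b \<bullet> b' = 0" if "b \<in> B" "b' \<in> B'" for b b'
  proof -
    have "b \<in> V" "b' \<in> V\<^sup>\<bottom>"
      using B(1) B'(1) that by (auto simp: onb_def span_base)
    then show ?thesis
      by (simp add: orthogonal_comp_def orthogonal_def)
  qed
  have disj: "B' \<inter> B = {}"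
    using orth B(1) by (force simp: onb_def)
  have UN: "onb UNIV (B' \<union> B)"
  proof -
    have "span (B' \<union> B) = {x + y |x y. x \<in> V\<^sup>\<bottom> \<and> y \<in> V}"
      using B(1) B'(1) by (simp add: span_Un onb_def)
    also have "\<dots> = V\<^sup>\<bottom> + V"
      unfolding set_plus_def by blast
    also have "\<dots> = UNIV"
      using subspace_sum_orthogonal_comp[OF V] by (simp add: add.commute)
    finally show ?thesis
      using B(1) B'(1) orth inner_commute
      unfolding onb_def pairwise_def orthogonal_def by (metis Un_iff)
  qed
  let ?f = "\<lambda>B c. \<Sum>b\<in>B. c b *\<^sub>R b :: real ^ 'n"
  let ?M = "\<lambda>B :: (real ^ 'n) set. \<Pi>\<^sub>M b\<in>B. lborel :: real measure"
  interpret MB: sigma_finite_measure "?M B"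
    using onb_finite[OF B(1)] by (rule lborel_product.sigma_finite)
  have [measurable]: "?f B \<in> borel_measurable (?M B)" "?f B' \<in> borel_measurable (?M B')"
    by measurable
  have inner: "emeasure (subspace_lborel V) {v. u + v \<in> S} = (\<integral>\<^sup>+y. indicator S (u + ?f B y) \<partial>?M B)" for u
  proof -
    have 1: "{v. u + v \<in> S} \<in> sets borel"
      by measurable
    have "emeasure (subspace_lborel V) {v. u + v \<in> S}
        = (\<integral>\<^sup>+v. indicator {v. u + v \<in> S} v \<partial>subspace_lborel V)"
      using 1 by simp
    also have "\<dots> = (\<integral>\<^sup>+y. indicator S (u + ?f B y) \<partial>?M B)"
      unfolding B(2) using 1
      by (subst nn_integral_distr) (auto simp: indicator_def intro!: nn_integral_cong)
    finally show ?thesis .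
  qed
  have "emeasure lborel S = (\<integral>\<^sup>+x. indicator S x \<partial>distr (?M (B' \<union> B)) borel (?f (B' \<union> B)))"
    using distr_PiM_onb_UNIV[OF UN] by simp
  also have "\<dots> = (\<integral>\<^sup>+c. indicator S (?f (B' \<union> B) c) \<partial>?M (B' \<union> B))"
    by (subst nn_integral_distr) auto
  also have "\<dots> = (\<integral>\<^sup>+x. \<integral>\<^sup>+y. indicator S (?f (B' \<union> B) (merge B' B (x, y))) \<partial>?M B \<partial>?M B')"
    using disj onb_finite[OF B(1)] onb_finite[OF B'(1)]
    by (intro lborel_product.product_nn_integral_fold) measurable
  also have "\<dots> = (\<integral>\<^sup>+x. \<integral>\<^sup>+y. indicator S (?f B' x + ?f B y) \<partial>?M B \<partial>?M B')"
  proof -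
    have "?f (B' \<union> B) (merge B' B (x, y)) = ?f B' x + ?f B y" for x y
      using disj onb_finite[OF B(1)] onb_finite[OF B'(1)]
      by (subst sum.union_disjoint) (auto simp: merge_def intro!: arg_cong2[where f = "(+)"] sum.cong)
    then show ?thesis
      by simp
  qed
  also have "\<dots> = (\<integral>\<^sup>+u. \<integral>\<^sup>+y. indicator S (u + ?f B y) \<partial>?M B \<partial>subspace_lborel (V\<^sup>\<bottom>))"
    unfolding B'(2) by (subst nn_integral_distr) measurable
  finally show ?thesis
    by (simp add: inner)
qed

section \<open>Norms and orthogonal projections\<close>

context
  fixes f :: "real ^ 'n \<Rightarrow> real"
  assumes f: "is_norm f"
begin

lemma is_norm_nonneg: "0 \<le> f x"
  and is_norm_eq_0_iff: "f x = 0 \<longleftrightarrow> x = 0"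
  and is_norm_scaleR: "f (c *\<^sub>R x) = \<bar>c\<bar> * f x"
  and is_norm_triangle: "f (x + y) \<le> f x + f y"
  using f by (auto simp: is_norm_def)

lemma is_norm_minus: "f (- x) = f x"
  using is_norm_scaleR[of "-1" x] by simp

lemma is_norm_diff_commute: "f (x - y) = f (y - x)"
  using is_norm_minus[of "x - y"] by simp

lemma is_norm_sum: "finite A \<Longrightarrow> f (sum g A) \<le> (\<Sum>a\<in>A. f (g a))"
proof (induction A rule: finite_induct)
  case (insert a A)
  then show ?case
    using is_norm_triangle[of "g a" "sum g A"] by simp
qed (use is_norm_eq_0_iff[of 0] in simp)

text \<open>Expansion in the standard basis bounds \<open>f x\<close> by the sum of the values on
  basis vectors; the added 1 makes the constant visibly positive.\<close>

lemma is_norm_le_norm: "\<exists>M>0. \<forall>x. f x \<le> M * norm x"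
proof (intro exI conjI allI)
  let ?M = "(\<Sum>b\<in>Basis. f b) + 1"
  show "0 < ?M"
    by (intro add_nonneg_pos sum_nonneg is_norm_nonneg) simp
  fix x
  have "f x = f (\<Sum>b\<in>Basis. (x \<bullet> b) *\<^sub>R b)"
    by (simp add: euclidean_representation)
  also have "\<dots> \<le> (\<Sum>b\<in>Basis. f ((x \<bullet> b) *\<^sub>R b))"
    by (rule is_norm_sum) simp
  also have "\<dots> \<le> (\<Sum>b\<in>Basis. norm x * f b)"
    by (intro sum_mono) (auto simp: is_norm_scaleR Basis_le_norm is_norm_nonneg intro!: mult_right_mono)
  also have "\<dots> \<le> ?M * norm x"
    by (simp add: sum_distrib_left[symmetric] algebra_simps)
  finally show "f x \<le> ?M * norm x" .
qed

lemma is_norm_continuous: "continuous_on S f"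
proof -
  obtain M where M: "0 < M" "\<And>x. f x \<le> M * norm x"
    using is_norm_le_norm by blast
  have "\<bar>f x - f y\<bar> \<le> M * dist x y" for x y
    using is_norm_triangle[of "x - y" y] is_norm_triangle[of "y - x" x] M(2)[of "x - y"]
      is_norm_diff_commute[of x y] by (simp add: dist_norm abs_le_iff)
  then have "M-lipschitz_on S f"
    using M(1) by (intro lipschitz_onI) (auto simp: dist_real_def)
  then show ?thesis
    by (rule lipschitz_on_continuous_on)
qed

text \<open>By compactness \<open>f\<close> attains a positive minimum on the Euclidean unit sphere;
  homogeneity extends the bound to all vectors.\<close>

lemma norm_le_is_norm: "\<exists>M>0. \<forall>x. norm x \<le> M * f x"
proof -
  have "\<exists>x\<in>sphere 0 1. \<forall>y\<in>sphere 0 1. f x \<le> f y"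
    by (rule continuous_attains_inf) (auto simp: is_norm_continuous intro: vector_choose_size[of 1])
  then obtain x0 where x0: "norm x0 = 1" "\<And>y. norm y = 1 \<Longrightarrow> f x0 \<le> f y"
    by auto
  have "x0 \<noteq> 0"
    using x0(1) by auto
  then have pos: "0 < f x0"
    using is_norm_nonneg[of x0] is_norm_eq_0_iff[of x0] by linarith
  show ?thesis
  proof (intro exI conjI allI)
    show "0 < 1 / f x0"
      using pos by simp
    fix x
    show "norm x \<le> 1 / f x0 * f x"
    proof (cases "x = 0")
      case False
      then have "f x0 \<le> f ((1 / norm x) *\<^sub>R x)"
        by (intro x0) simp
      then show ?thesis
        using False pos by (simp add: is_norm_scaleR field_simps)
    qed (simp add: is_norm_nonneg pos)
  qed
qed

lemma lev_is_norm_compact: "compact (lev f t)"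
proof -
  obtain M where M: "0 < M" "\<And>x. norm x \<le> M * f x"
    using norm_le_is_norm by blast
  have "lev f t \<subseteq> cball 0 (M * t)"
    using M by (auto simp: lev_def intro!: order_trans[OF M(2)])
  then have "bounded (lev f t)"
    by (rule bounded_subset[OF bounded_cball])
  moreover have "closed (lev f t)"
    unfolding lev_def by (intro closed_Collect_le is_norm_continuous continuous_on_const)
  ultimately show ?thesis
    by (simp add: compact_eq_bounded_closed)
qed

lemma lev_is_norm_scale:
  assumes "0 < c"
  shows "(*\<^sub>R) c ` lev f t = lev f (c * t)"
proof
  show "(*\<^sub>R) c ` lev f t \<subseteq> lev f (c * t)"
    using assms by (auto simp: lev_def is_norm_scaleR)
  show "lev f (c * t) \<subseteq> (*\<^sub>R) c ` lev f t"
  proof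
    fix x assume x: "x \<in> lev f (c * t)"
    have "x = c *\<^sub>R ((1 / c) *\<^sub>R x)"
      using assms by simp
    moreover have "(1 / c) *\<^sub>R x \<in> lev f t"
      using x assms by (simp add: lev_def is_norm_scaleR field_simps)
    ultimately show "x \<in> (*\<^sub>R) c ` lev f t"
      by blast
  qed
qed

text \<open>The level set contains a Euclidean ball of radius \<open>t / M\<close>. Positivity is
  needed because this volume is the denominator of the uniform law.\<close>

lemma measure_lev_is_norm_pos:
  assumes "0 < t"
  shows "0 < measure lborel (lev f t)"
proof -
  obtain M where M: "0 < M" "\<And>x. f x \<le> M * norm x"
    using is_norm_le_norm by blast
  have sub: "ball 0 (t / M) \<subseteq> lev f t"
  proof
    fix x :: "real ^ 'n" assume "x \<in> ball 0 (t / M)"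
    then have "M * norm x \<le> t"
      using M(1) by (simp add: field_simps)
    then show "x \<in> lev f t"
      using M(2)[of x] by (simp add: lev_def)
  qed
  have "0 < measure lborel (ball (0 :: real ^ 'n) (t / M))"
    using assms M(1) content_ball_pos by (metis divide_pos_pos measure_completion borel_open open_ball sets_lborel)
  also have "\<dots> \<le> measure lborel (lev f t)"
    using sub lev_is_norm_compact[of t] emeasure_compact_finite[of "lev f t"]
    by (intro measure_mono_fmeasurable) (auto intro!: fmeasurableI borel_compact)
  finally show ?thesis .
qed

end

section \<open>Orthogonal projections\<close>

context
  fixes V :: "(real ^ 'n) set"
  assumes V: "subspace V"
begin

text \<open>The difference of two candidates lies both in \<open>V\<close> and in its complement, so
  it is orthogonal to itself. This rule replaces the \<open>THE\<close> in the definition from here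
  on.\<close>

lemma proj_eqI:
  assumes "y \<in> V" "x - y \<in> V\<^sup>\<bottom>"
  shows "proj V x = y"
  unfolding proj_def
proof (rule the_equality)
  fix z assume z: "z \<in> V \<and> x - z \<in> V\<^sup>\<bottom>"
  have "z - y \<in> V"
    using V assms z by (auto intro: subspace_diff)
  moreover have "(x - y) - (x - z) \<in> V\<^sup>\<bottom>"
    using assms z by (blast intro: subspace_diff[OF subspace_orthogonal_comp])
  ultimately have "orthogonal (z - y) (z - y)"
    by (auto simp: orthogonal_comp_def)
  then show "z = y"
    by (simp add: orthogonal_def)
qed (use assms in auto)

lemma proj_mem: "proj V x \<in> V"
  and proj_diff_mem: "x - proj V x \<in> V\<^sup>\<bottom>"
proof -
  have "x \<in> V + V\<^sup>\<bottom>"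
    using subspace_sum_orthogonal_comp[OF V] by simp
  then obtain y z where "y \<in> V" "z \<in> V\<^sup>\<bottom>" "x = y + z"
    by (auto elim: set_plus_elim)
  then show "proj V x \<in> V" "x - proj V x \<in> V\<^sup>\<bottom>"
    using proj_eqI[of y x] by auto
qed

lemma linear_proj: "linear (proj V)"
proof (rule linearI)
  fix x y and c :: real
  have "(x - proj V x) + (y - proj V y) \<in> V\<^sup>\<bottom>"
    by (intro subspace_add subspace_orthogonal_comp proj_diff_mem)
  then show "proj V (x + y) = proj V x + proj V y"
    by (intro proj_eqI subspace_add[OF V] proj_mem) (simp add: algebra_simps)
  have "c *\<^sub>R (x - proj V x) \<in> V\<^sup>\<bottom>"
    by (intro subspace_scale subspace_orthogonal_comp proj_diff_mem)
  then show "proj V (c *\<^sub>R x) = c *\<^sub>R proj V x"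
    by (intro proj_eqI subspace_scale[OF V] proj_mem) (simp add: algebra_simps)
qed

end

lemma proj_orthogonal_comp:
  assumes "subspace V"
  shows "proj (V\<^sup>\<bottom>) x = x - proj V x"
proof -
  have "x - (x - proj V x) \<in> V\<^sup>\<bottom>\<^sup>\<bottom>"
    using proj_mem[OF assms, of x] orthogonal_comp_subset[of V] by auto
  then show ?thesis
    using assms by (intro proj_eqI subspace_orthogonal_comp proj_diff_mem)
qed

lemma proj_orthogonal_comp_add:
  assumes "subspace V" "u \<in> V\<^sup>\<bottom>" "v \<in> V"
  shows "proj (V\<^sup>\<bottom>) (u + v) = u"
  using assms proj_eqI[of V v "u + v"] by (simp add: proj_orthogonal_comp)

section \<open>Slabs around spans of dictionary subsets\<close>

lemma T_subspace [simp]: "subspace (T \<psi> J)"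
  by (simp add: T_def)

text \<open>A slab is a cylinder: membership depends only on the component orthogonal to
  \<open>T \<psi> J\<close>. This form yields closedness and the shape of the slices.\<close>

lemma Tt_altdef:
  fixes \<psi> :: "'i \<Rightarrow> real ^ 'n"
  shows "Tt \<psi> nrm \<tau> J = proj ((T \<psi> J)\<^sup>\<bottom>) -` proj ((T \<psi> J)\<^sup>\<bottom>) ` lev nrm \<tau>"
proof -
  let ?V = "T \<psi> J"
  have "x \<in> Tt \<psi> nrm \<tau> J" if "proj (?V\<^sup>\<bottom>) x \<in> proj (?V\<^sup>\<bottom>) ` lev nrm \<tau>" for x
  proof -
    have "x = proj ?V x + proj (?V\<^sup>\<bottom>) x"
      by (simp add: proj_orthogonal_comp)
    then show ?thesis
      using that proj_mem[OF T_subspace] unfolding Tt_def by blast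
  qed
  moreover have "proj (?V\<^sup>\<bottom>) x \<in> proj (?V\<^sup>\<bottom>) ` lev nrm \<tau>" if "x \<in> Tt \<psi> nrm \<tau> J" for x
  proof -
    from \<open>x \<in> Tt \<psi> nrm \<tau> J\<close> obtain v u where
      x: "x = v + u" "v \<in> ?V" "u \<in> proj (?V\<^sup>\<bottom>) ` lev nrm \<tau>"
      unfolding Tt_def by blast
    moreover have "u \<in> ?V\<^sup>\<bottom>"
      using x(3) proj_mem[OF subspace_orthogonal_comp] by auto
    ultimately show ?thesis
      using proj_orthogonal_comp_add[of ?V u v] by (simp add: add.commute)
  qed
  ultimately show ?thesis
    by auto
qed

text \<open>Links the geometry to the optimization problem: two points with the same projection onto
  the complement differ by an element of \<open>T \<psi> J\<close>.\<close>

lemma mem_Tt_iff: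
  fixes \<psi> :: "'i \<Rightarrow> real ^ 'n"
  assumes "is_norm nrm"
  shows "x \<in> Tt \<psi> nrm \<tau> J \<longleftrightarrow> (\<exists>y\<in>T \<psi> J. nrm (y - x) \<le> \<tau>)"
proof
  let ?V = "T \<psi> J"
  assume "x \<in> Tt \<psi> nrm \<tau> J"
  then obtain w where w: "nrm w \<le> \<tau>" "proj (?V\<^sup>\<bottom>) x = proj (?V\<^sup>\<bottom>) w"
    by (auto simp: Tt_altdef lev_def)
  have "x - w = proj ?V x - proj ?V w"
    using w(2) by (simp add: proj_orthogonal_comp algebra_simps)
  then have "x - w \<in> ?V"
    by (simp add: proj_mem subspace_diff)
  then show "\<exists>y\<in>?V. nrm (y - x) \<le> \<tau>"
    using w(1) by (intro bexI[of _ "x - w"]) (simp_all add: is_norm_minus[OF assms])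
next
  let ?V = "T \<psi> J"
  assume "\<exists>y\<in>?V. nrm (y - x) \<le> \<tau>"
  then obtain y where y: "y \<in> ?V" "nrm (x - y) \<le> \<tau>"
    using is_norm_diff_commute[OF assms] by metis
  have "proj ?V y = y"
    using y(1) by (intro proj_eqI) (auto simp: orthogonal_comp_def orthogonal_def)
  then have "proj (?V\<^sup>\<bottom>) x = proj (?V\<^sup>\<bottom>) (x - y)"
    by (simp add: proj_orthogonal_comp linear_diff[OF linear_proj])
  then show "x \<in> Tt \<psi> nrm \<tau> J"
    using y(2) by (auto simp: Tt_altdef lev_def)
qed

lemma proj_lev_compact:
  assumes "is_norm nrm" "subspace V"
  shows "compact (proj V ` lev nrm t)"
  using linear_proj[OF assms(2)] lev_is_norm_compact[OF assms(1)]
  by (intro compact_continuous_image linear_continuous_on) (auto simp: linear_conv_bounded_linear)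

lemma Tt_closed:
  assumes "is_norm nrm"
  shows "closed (Tt \<psi> nrm \<tau> J)"
  unfolding Tt_altdef
  using linear_proj[OF subspace_orthogonal_comp] assms
  by (intro continuous_closed_vimage compact_imp_closed proj_lev_compact subspace_orthogonal_comp
      linear_continuous_at) (auto simp: linear_conv_bounded_linear)

text \<open>The offsets of nonempty slices form the projected ball of size \<tau>, whose volume
  scales with exponent N - K; the balls inside \<open>T \<psi> J\<close> scale with exponent K. The
  two unit volumes multiply to \<open>C\<close>. The shift \<delta> * \<tau> of the radius is the
  bound on \<open>fd\<close> over the offsets, used with the triangle inequality in both
  directions.\<close>

lemma measure_Tt_lev_bounds:
  fixes \<psi> :: "'i \<Rightarrow> real ^ 'n"
  assumes nrm: "is_norm nrm" and fd: "is_norm fd"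
    and \<delta>0: "0 \<le> \<delta>" and \<delta>: "\<And>u. u \<in> (T \<psi> J)\<^sup>\<bottom> \<Longrightarrow> fd u \<le> \<delta> * h \<psi> nrm J u"
    and \<tau>: "0 < \<tau>" and \<theta>: "\<delta> * \<tau> \<le> \<theta>" "0 < \<theta>"
  defines "K \<equiv> dim (T \<psi> J)" and "S \<equiv> Tt \<psi> nrm \<tau> J \<inter> lev fd \<theta>"
  shows "C \<psi> nrm fd J * \<tau> ^ (CARD('n) - K) * (\<theta> - \<delta> * \<tau>) ^ K \<le> measure lborel S"
    and "measure lborel S \<le> C \<psi> nrm fd J * \<tau> ^ (CARD('n) - K) * (\<theta> + \<delta> * \<tau>) ^ K"
proof -
  let ?V = "T \<psi> J"
  let ?W = "?V\<^sup>\<bottom>"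
  let ?\<mu> = "subspace_lborel ?V" and ?\<nu> = "subspace_lborel ?W"
  let ?P = "\<lambda>t. proj ?W ` lev nrm t" and ?L = "\<lambda>t. ?V \<inter> lev fd t"
  have W: "subspace ?W"
    by (rule subspace_orthogonal_comp)
  have dimW: "dim ?W = CARD('n) - K"
    using dim_subspace_orthogonal_to_vectors[of ?V UNIV]
    by (simp add: K_def orthogonal_comp_def orthogonal_commute)
  have PW: "?P t \<subseteq> ?W" for t
    using proj_mem[OF W] by auto
  have P_compact: "compact (?P t)" for t
    by (rule proj_lev_compact[OF nrm W])
  have L_compact: "compact (?L t)" for t
    using closed_subspace[of ?V] lev_is_norm_compact[OF fd] by (intro closed_Int_compact) auto
  have P_borel[measurable]: "?P t \<in> sets borel" for t
    using P_compact by (rule borel_compact)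
  have L_borel[measurable]: "?L t \<in> sets borel" for t
    using L_compact by (rule borel_compact)
  have P_fin: "emeasure ?\<nu> (?P t) = ennreal (measure ?\<nu> (?P t))" for t
    using emeasure_subspace_lborel_finite[OF W compact_imp_bounded[OF P_compact]]
    by (intro emeasure_eq_ennreal_measure) (simp add: less_top)
  have L_fin: "emeasure ?\<mu> (?L t) = ennreal (measure ?\<mu> (?L t))" for t
    using emeasure_subspace_lborel_finite[OF _ compact_imp_bounded[OF L_compact]]
    by (intro emeasure_eq_ennreal_measure) (simp add: less_top)
  have P_image: "?P \<tau> = (*\<^sub>R) \<tau> ` ?P 1"
  proof -
    have "?P \<tau> = proj ?W ` (*\<^sub>R) \<tau> ` lev nrm 1"
      using lev_is_norm_scale[OF nrm \<tau>, of 1] by simp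
    also have "\<dots> = (*\<^sub>R) \<tau> ` ?P 1"
      by (simp add: image_image linear_cmul[OF linear_proj[OF W]])
    finally show ?thesis .
  qed
  have P_scale: "measure ?\<nu> (?P \<tau>) = \<tau> ^ (CARD('n) - K) * measure ?\<nu> (?P 1)"
  proof -
    have "emeasure ?\<nu> (?P \<tau>) = ennreal (\<tau> ^ dim ?W) * emeasure ?\<nu> (?P 1)"
      unfolding P_image using emeasure_subspace_lborel_scale[OF W P_borel \<tau>] .
    then show ?thesis
      using \<tau> unfolding P_fin by (simp add: dimW flip: ennreal_mult)
  qed
  have L_scale: "measure ?\<mu> (?L t) = t ^ K * measure ?\<mu> (?L 1)" if "0 < t" for t
  proof -
    have "(*\<^sub>R) t ` ?V = ?V"
      using that by (auto simp: subspace_scale image_iff intro!: bexI[of _ "(1 / t) *\<^sub>R _"])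
    then have "?L t = (*\<^sub>R) t ` ?L 1"
      using lev_is_norm_scale[OF fd that, of 1] that by (simp add: image_Int inj_on_def)
    then have "emeasure ?\<mu> (?L t) = ennreal (t ^ dim ?V) * emeasure ?\<mu> (?L 1)"
      using emeasure_subspace_lborel_scale[OF T_subspace L_borel[of 1] that] by simp
    then show ?thesis
      using that unfolding L_fin by (simp add: K_def flip: ennreal_mult)
  qed
  have S_compact: "compact S"
    unfolding S_def using Tt_closed[OF nrm] lev_is_norm_compact[OF fd] by (rule closed_Int_compact)
  then have S_borel[measurable]: "S \<in> sets borel"
    by (rule borel_compact)
  have S_fin: "emeasure lborel S = ennreal (measure lborel S)"
    using emeasure_compact_finite[OF S_compact] by (intro emeasure_eq_ennreal_measure) (simp add: less_top)
  \<comment> \<open>For such \<open>u\<close> the number \<tau> itself belongs to the set whose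
    infimum is \<open>h\<close>, so the gauge is at most \<tau>.\<close>
  have fd_u: "fd u \<le> \<delta> * \<tau>" if "u \<in> ?P \<tau>" for u
  proof -
    obtain w where "u = \<tau> *\<^sub>R w" "w \<in> ?P 1"
      using \<open>u \<in> ?P \<tau>\<close> unfolding P_image by blast
    then have "(1 / \<tau>) *\<^sub>R u \<in> ?P 1"
      using \<tau> by simp
    then have "h \<psi> nrm J u \<le> \<tau>"
      unfolding h_def using \<tau> by (intro cInf_lower bdd_belowI[of _ 0]) auto
    moreover have "fd u \<le> \<delta> * h \<psi> nrm J u"
      using that PW by (intro \<delta>) auto
    ultimately show ?thesis
      using \<delta>0 by (meson mult_left_mono order_trans)
  qed
  \<comment> \<open>Moving by \<open>v\<close> inside \<open>?V\<close> does not change the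
    projection \<open>u\<close>, so the slab condition constrains the offset alone.\<close>
  have slice: "?V \<inter> {v. u + v \<in> S} = {v \<in> ?V. u \<in> ?P \<tau> \<and> fd (u + v) \<le> \<theta>}" if "u \<in> ?W" for u
    using that proj_orthogonal_comp_add[of ?V u] by (auto simp: S_def Tt_altdef lev_def)
  have \<mu>_slice: "emeasure ?\<mu> {v. u + v \<in> S} = emeasure ?\<mu> (?V \<inter> {v. u + v \<in> S})" for u
    by (intro emeasure_subspace_lborel_Int) auto
  \<comment> \<open>The description of slices requires \<open>u \<in> ?W\<close>; the offset measure
    is concentrated there, so the integral may be restricted.\<close>
  have AE_W: "(\<integral>\<^sup>+u. g u \<partial>?\<nu>) = (\<integral>\<^sup>+u. g u * indicator ?W u \<partial>?\<nu>)" for g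
  proof (rule nn_integral_cong_AE)
    have "emeasure ?\<nu> (- ?W) = 0"
      using emeasure_subspace_lborel_Int[OF W, of "- ?W"] closed_subspace[OF W] by auto
    then have "AE u in ?\<nu>. u \<in> ?W"
      using closed_subspace[OF W] by (intro AE_I[of _ _ "- ?W"]) auto
    then show "AE u in ?\<nu>. g u = g u * indicator ?W u"
      by eventually_elim simp
  qed
  have eS: "emeasure lborel S = (\<integral>\<^sup>+u. emeasure ?\<mu> (?V \<inter> {v. u + v \<in> S}) * indicator ?W u \<partial>?\<nu>)"
    by (simp only: emeasure_lborel_orthogonal_decomp[OF T_subspace S_borel, of \<psi> J] \<mu>_slice
        AE_W[symmetric])
  have box: "(\<integral>\<^sup>+u. emeasure ?\<mu> (?L t) * indicator (?P \<tau>) u \<partial>?\<nu>)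
      = ennreal (measure ?\<mu> (?L t) * (\<tau> ^ (CARD('n) - K) * measure ?\<nu> (?P 1)))" for t
    using P_borel less_imp_le[OF \<tau>] by (subst nn_integral_cmult_indicator)
      (simp_all add: P_fin L_fin P_scale ennreal_mult'')
  have C_eq: "C \<psi> nrm fd J = measure ?\<nu> (?P 1) * measure ?\<mu> (?L 1)"
    by (simp add: C_def)
  have "emeasure lborel S \<le> (\<integral>\<^sup>+u. emeasure ?\<mu> (?L (\<theta> + \<delta> * \<tau>)) * indicator (?P \<tau>) u \<partial>?\<nu>)"
    unfolding eS
  proof (rule nn_integral_mono)
    fix u
    have "?V \<inter> {v. u + v \<in> S} \<subseteq> ?L (\<theta> + \<delta> * \<tau>)" if "u \<in> ?W"
    proof
      fix v assume "v \<in> ?V \<inter> {v. u + v \<in> S}"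
      then have v: "v \<in> ?V" "u \<in> ?P \<tau>" "fd (u + v) \<le> \<theta>"
        using slice[OF that] by auto
      have "fd ((u + v) + - u) \<le> fd (u + v) + fd u"
        using is_norm_triangle[OF fd, of "u + v" "- u"] by (simp add: is_norm_minus[OF fd])
      then show "v \<in> ?L (\<theta> + \<delta> * \<tau>)"
        using v fd_u[OF v(2)] by (simp add: lev_def)
    qed
    moreover have "?V \<inter> {v. u + v \<in> S} = {}" if "u \<in> ?W" "u \<notin> ?P \<tau>"
      using slice[OF that(1)] that(2) by auto
    ultimately show "emeasure ?\<mu> (?V \<inter> {v. u + v \<in> S}) * indicator ?W u
        \<le> emeasure ?\<mu> (?L (\<theta> + \<delta> * \<tau>)) * indicator (?P \<tau>) u"
      by (cases "u \<in> ?W"; cases "u \<in> ?P \<tau>") (auto intro!: emeasure_mono)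
  qed
  then have "measure lborel S
      \<le> measure ?\<mu> (?L (\<theta> + \<delta> * \<tau>)) * (\<tau> ^ (CARD('n) - K) * measure ?\<nu> (?P 1))"
    using \<tau> unfolding box S_fin by (subst (asm) ennreal_le_iff) auto
  also have "0 < \<theta> + \<delta> * \<tau>"
    using \<theta> \<delta>0 \<tau> by (intro add_pos_nonneg) auto
  from L_scale[OF this]
  have "measure ?\<mu> (?L (\<theta> + \<delta> * \<tau>)) * (\<tau> ^ (CARD('n) - K) * measure ?\<nu> (?P 1))
      = C \<psi> nrm fd J * \<tau> ^ (CARD('n) - K) * (\<theta> + \<delta> * \<tau>) ^ K"
    by (simp add: C_eq)
  finally show "measure lborel S \<le> C \<psi> nrm fd J * \<tau> ^ (CARD('n) - K) * (\<theta> + \<delta> * \<tau>) ^ K" .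

  have "(\<integral>\<^sup>+u. emeasure ?\<mu> (?L (\<theta> - \<delta> * \<tau>)) * indicator (?P \<tau>) u \<partial>?\<nu>) \<le> emeasure lborel S"
    unfolding eS
  proof (rule nn_integral_mono)
    fix u
    have "?L (\<theta> - \<delta> * \<tau>) \<subseteq> ?V \<inter> {v. u + v \<in> S}" if "u \<in> ?P \<tau>"
    proof
      fix v assume v: "v \<in> ?L (\<theta> - \<delta> * \<tau>)"
      then have "fd (u + v) \<le> \<theta>"
        using is_norm_triangle[OF fd, of u v] fd_u[OF that] by (simp add: lev_def)
      then show "v \<in> ?V \<inter> {v. u + v \<in> S}"
        using v that PW[of \<tau>] slice[of u] by auto
    qed
    moreover have "?V \<inter> {v. u + v \<in> S} \<in> sets borel"
      using closed_subspace[of ?V] by (intro sets.Int) auto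
    ultimately show "emeasure ?\<mu> (?L (\<theta> - \<delta> * \<tau>)) * indicator (?P \<tau>) u
        \<le> emeasure ?\<mu> (?V \<inter> {v. u + v \<in> S}) * indicator ?W u"
      using PW[of \<tau>] by (cases "u \<in> ?P \<tau>") (simp_all add: subset_iff emeasure_mono del: image_iff)
  qed
  then have "measure ?\<mu> (?L (\<theta> - \<delta> * \<tau>)) * (\<tau> ^ (CARD('n) - K) * measure ?\<nu> (?P 1))
      \<le> measure lborel S"
    unfolding box S_fin by (subst (asm) ennreal_le_iff) auto
  \<comment> \<open>The scaling law needs a positive radius, but \<theta> = \<delta> * \<tau> is
    allowed. At radius 0 the left power vanishes if K > 0, while for K = 0 every ball of nonnegative
    radius is {0} and \<open>0 ^ 0 = 1\<close>.\<close>
  moreover have "measure ?\<mu> (?L (\<theta> - \<delta> * \<tau>)) \<ge> (\<theta> - \<delta> * \<tau>) ^ K * measure ?\<mu> (?L 1)"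
  proof (cases "\<theta> - \<delta> * \<tau> = 0")
    case True
    show ?thesis
    proof (cases "K = 0")
      case K0: True
      then have V0: "?V = {0}"
        using subspace_0[of ?V] by (auto simp: K_def)
      have "?L t = {0}" if "0 \<le> t" for t
        using that is_norm_eq_0_iff[OF fd, of 0] V0 by (auto simp: lev_def)
      then show ?thesis
        using True K0 by simp
    qed (use True in \<open>simp add: power_0_left\<close>)
  next
    case False
    then show ?thesis
      using L_scale[of "\<theta> - \<delta> * \<tau>"] \<theta> by simp
  qed
  then have "(\<theta> - \<delta> * \<tau>) ^ K * measure ?\<mu> (?L 1) * (\<tau> ^ (CARD('n) - K) * measure ?\<nu> (?P 1))
      \<le> measure ?\<mu> (?L (\<theta> - \<delta> * \<tau>)) * (\<tau> ^ (CARD('n) - K) * measure ?\<nu> (?P 1))"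
    using \<tau> by (intro mult_right_mono) auto
  ultimately show "C \<psi> nrm fd J * \<tau> ^ (CARD('n) - K) * (\<theta> - \<delta> * \<tau>) ^ K \<le> measure lborel S"
    by (simp add: C_eq mult_ac)
qed

section \<open>The full space and the uniform law\<close>

lemma subspace_lborel_UNIV: "subspace_lborel (UNIV :: (real ^ 'n) set) = lborel"
proof -
  obtain B :: "(real ^ 'n) set" where "onb UNIV B"
    "subspace_lborel UNIV = distr (\<Pi>\<^sub>M b\<in>B. lborel) borel (\<lambda>c. \<Sum>b\<in>B. c b *\<^sub>R b)"
    using subspace_lborel_onb[OF subspace_UNIV] .
  then show ?thesis
    by (simp only: distr_PiM_onb_UNIV)
qed

lemma measure_lev_is_norm_scale:
  fixes f :: "real ^ 'n \<Rightarrow> real"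
  assumes "is_norm f" "0 < t"
  shows "measure lborel (lev f t) = t ^ CARD('n) * measure lborel (lev f 1)"
  using emeasure_subspace_lborel_scale[OF subspace_UNIV borel_compact[OF lev_is_norm_compact[OF assms(1), of 1]] assms(2)]
    lev_is_norm_scale[OF assms, of 1] assms(2)
  by (simp add: subspace_lborel_UNIV measure_def enn2real_mult)

lemma measure_uniform_rv:
  fixes f :: "real ^ 'n \<Rightarrow> real"
  assumes f: "is_norm f" and \<theta>: "0 < \<theta>" and d: "uniform_rv M d (lev f \<theta>)" and A: "A \<in> sets borel"
  shows "measure M {\<omega> \<in> space M. d \<omega> \<in> A}
    = measure lborel (A \<inter> lev f \<theta>) / (\<theta> ^ CARD('n) * measure lborel (lev f 1))"
proof -
  have dm: "d \<in> borel_measurable M" and dd: "distr M borel d = uniform_measure lborel (lev f \<theta>)"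
    using d by (auto simp: uniform_rv_def)
  have "measure M {\<omega> \<in> space M. d \<omega> \<in> A} = measure (distr M borel d) A"
    using dm A by (simp add: measure_distr vimage_def Int_def conj_commute)
  also have "\<dots> = measure lborel (lev f \<theta> \<inter> A) / measure lborel (lev f \<theta>)"
    unfolding dd using measure_lev_is_norm_pos[OF f \<theta>] A
      emeasure_compact_finite[OF lev_is_norm_compact[OF f, of \<theta>]]
    by (intro measure_uniform_measure) (auto simp: measure_def)
  finally show ?thesis
    by (simp add: measure_lev_is_norm_scale[OF f \<theta>] Int_commute)
qed

section \<open>Sparse approximation\<close>

text \<open>Coefficients are indexed by \<open>A\<close> and not by vectors, since \<psi> may take a
  value more than once. In the induction \<open>k\<close> is the multiple of the new vector that
  brings \<open>x\<close> back into the smaller span.\<close>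

lemma span_image_sum:
  fixes \<psi> :: "'i \<Rightarrow> 'a::real_vector"
  assumes "finite A" "x \<in> span (\<psi> ` A)"
  shows "\<exists>c. x = (\<Sum>i\<in>A. c i *\<^sub>R \<psi> i)"
  using assms
proof (induction A arbitrary: x rule: finite_induct)
  case (insert a A)
  then obtain k where "x - k *\<^sub>R \<psi> a \<in> span (\<psi> ` A)"
    by (auto simp: span_breakdown_eq)
  then obtain c where c: "x - k *\<^sub>R \<psi> a = (\<Sum>i\<in>A. c i *\<^sub>R \<psi> i)"
    using insert.IH by blast
  have "(\<Sum>i\<in>insert a A. (c(a := k)) i *\<^sub>R \<psi> i) = k *\<^sub>R \<psi> a + (\<Sum>i\<in>A. (c(a := k)) i *\<^sub>R \<psi> i)"
    using insert.hyps by simp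
  also have "(\<Sum>i\<in>A. (c(a := k)) i *\<^sub>R \<psi> i) = (\<Sum>i\<in>A. c i *\<^sub>R \<psi> i)"
    using insert.hyps by (intro sum.cong) auto
  finally show ?case
    using c by (intro exI[of _ "c(a := k)"]) (simp add: algebra_simps)
qed simp

text \<open>Bonferroni's inequality over ordered pairs, so each overlap is counted twice; the
  ordered form matches \<open>H\<close> and \<open>Q_bar\<close>. Adding a set \<open>a\<close>
  loses its overlap with the old union, at most the sum of the overlaps indexed by the pairs (a,
  b).\<close>

lemma measure_UNION_ge:
  assumes "finite A" "\<And>a. a \<in> A \<Longrightarrow> S a \<in> fmeasurable M"
  shows "(\<Sum>a\<in>A. measure M (S a)) - (\<Sum>(a, b)\<in>{(a, b) \<in> A \<times> A. a \<noteq> b}. measure M (S a \<inter> S b))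
    \<le> measure M (\<Union>a\<in>A. S a)"
  using assms
proof (induction A rule: finite_induct)
  case (insert a A)
  let ?off = "\<lambda>A. {(a, b) \<in> A \<times> A. a \<noteq> b}"
  let ?m = "\<lambda>(a, b). measure M (S a \<inter> S b)"
  have fin: "finite (?off A)" if "finite A" for A
    by (rule finite_subset[of _ "A \<times> A"]) (use that in auto)
  have S: "S b \<in> fmeasurable M" if "b \<in> insert a A" for b
    using insert.prems that .
  have U: "(\<Union>b\<in>A. S b) \<in> fmeasurable M"
    using S insert.hyps by (intro fmeasurable.finite_UN) auto
  have "measure M (S a \<inter> (\<Union>b\<in>A. S b)) \<le> (\<Sum>b\<in>A. measure M (S a \<inter> S b))"
    unfolding Int_UN_distrib using S insert.hyps by (intro measure_UNION_le) (auto intro: fmeasurableD)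
  also have "\<dots> = sum ?m (Pair a ` A)"
    by (subst sum.reindex) (auto simp: inj_on_def)
  finally have 1: "measure M (S a \<inter> (\<Union>b\<in>A. S b)) \<le> sum ?m (Pair a ` A)" .
  have "sum ?m (?off A) + sum ?m (Pair a ` A) = sum ?m (?off A \<union> Pair a ` A)"
    using insert.hyps fin[OF insert.hyps(1)] by (intro sum.union_disjoint[symmetric]) auto
  \<comment> \<open>The reversed pairs (b, a) are missing on the left; their terms are
    nonnegative.\<close>
  also have "\<dots> \<le> sum ?m (?off (insert a A))"
  proof (rule sum_mono2)
    show "finite (?off (insert a A))"
      using insert.hyps by (intro fin) simp
  qed (use insert.hyps in auto)
  finally have 2: "sum ?m (?off A) + sum ?m (Pair a ` A) \<le> sum ?m (?off (insert a A))" .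
  have "measure M (\<Union>b\<in>insert a A. S b)
      = measure M (S a) + measure M (\<Union>b\<in>A. S b) - measure M (S a \<inter> (\<Union>b\<in>A. S b))"
    using measure_Un3[OF S U, of a] by simp
  with 1 2 insert.IH[OF S] insert.hyps show ?case
    by simp
qed simp

section \<open>Rescaling and asymptotics in the ratio r\<close>

text \<open>Pulls out the factor \<open>\<theta> ^ n\<close>, which later cancels against the volume
  of \<open>lev fd \<theta>\<close> and leaves functions of the ratio only. The sign of
  \<open>a\<close> is free, so both radii are covered.\<close>

lemma scale_ratio:
  fixes \<tau> \<theta> a :: real
  assumes "0 < \<theta>" "k \<le> n"
  shows "\<tau> ^ (n - k) * (\<theta> + a * \<tau>) ^ k = \<theta> ^ n * ((\<tau> / \<theta>) ^ (n - k) * (1 + a * (\<tau> / \<theta>)) ^ k)"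
proof -
  have "\<theta> ^ n * ((\<tau> / \<theta>) ^ (n - k) * (1 + a * (\<tau> / \<theta>)) ^ k)
      = (\<theta> ^ (n - k) * (\<tau> / \<theta>) ^ (n - k)) * (\<theta> ^ k * (1 + a * (\<tau> / \<theta>)) ^ k)"
    using assms(2) by (simp add: mult_ac flip: power_add)
  also have "\<dots> = (\<theta> * (\<tau> / \<theta>)) ^ (n - k) * (\<theta> * (1 + a * (\<tau> / \<theta>))) ^ k"
    by (simp only: power_mult_distrib)
  also have "\<dots> = \<tau> ^ (n - k) * (\<theta> + a * \<tau>) ^ k"
    using assms(1) by (simp add: algebra_simps)
  finally show ?thesis ..
qed

text \<open>After division by \<open>r ^ n\<close> a positive power of \<open>r\<close> remains and
  forces the limit 0.\<close>

lemma monomial_smallo_at_right_0: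
  fixes b c :: real
  assumes "n < a"
  shows "(\<lambda>r. c * r ^ a * (1 + b * r) ^ k) \<in> o[at_right 0](\<lambda>r. r ^ n)"
proof (rule smalloI_tendsto)
  have "((\<lambda>r. c * r ^ (a - n) * (1 + b * r) ^ k) \<longlongrightarrow> c * 0 ^ (a - n) * (1 + b * 0) ^ k) (at_right 0)"
    by (intro tendsto_intros)
  also have "c * 0 ^ (a - n) * (1 + b * 0) ^ k = 0"
    using assms by simp
  also have "((\<lambda>r. c * r ^ (a - n) * (1 + b * r) ^ k) \<longlongrightarrow> 0) (at_right 0)
      \<longleftrightarrow> ((\<lambda>r. c * r ^ a * (1 + b * r) ^ k / r ^ n) \<longlongrightarrow> 0) (at_right 0)"
  proof (rule filterlim_cong)
    show "\<forall>\<^sub>F r in at_right 0. c * r ^ (a - n) * (1 + b * r) ^ k = c * r ^ a * (1 + b * r) ^ k / r ^ n"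
      using eventually_at_right_less[of "0 :: real"]
      by eventually_elim (use assms in \<open>simp add: power_diff\<close>)
  qed simp_all
  finally show "((\<lambda>r. c * r ^ a * (1 + b * r) ^ k / r ^ n) \<longlongrightarrow> 0) (at_right 0)" .
  show "\<forall>\<^sub>F r in at_right 0. (r :: real) ^ n \<noteq> 0"
    using eventually_at_right_less[of "0 :: real"] by eventually_elim simp
qed

text \<open>The factor \<open>(1 + b * r) ^ k\<close> tends to 1, so dropping it from a main term
  changes only lower-order contributions.\<close>

lemma monomial_diff_smallo_at_right_0:
  fixes b c :: real
  shows "(\<lambda>r. c * r ^ n * (1 + b * r) ^ k - c * r ^ n) \<in> o[at_right 0](\<lambda>r. r ^ n)"
proof (rule smalloI_tendsto)
  have "((\<lambda>r. c * (1 + b * r) ^ k - c) \<longlongrightarrow> c * (1 + b * 0) ^ k - c) (at_right 0)"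
    by (intro tendsto_intros)
  also have "c * (1 + b * 0) ^ k - c = 0"
    by simp
  also have "((\<lambda>r. c * (1 + b * r) ^ k - c) \<longlongrightarrow> 0) (at_right 0)
      \<longleftrightarrow> ((\<lambda>r. (c * r ^ n * (1 + b * r) ^ k - c * r ^ n) / r ^ n) \<longlongrightarrow> 0) (at_right 0)"
  proof (rule filterlim_cong)
    show "\<forall>\<^sub>F r in at_right 0. c * (1 + b * r) ^ k - c = (c * r ^ n * (1 + b * r) ^ k - c * r ^ n) / r ^ n"
      using eventually_at_right_less[of "0 :: real"]
      by eventually_elim (simp add: field_simps)
  qed simp_all
  finally show "((\<lambda>r. (c * r ^ n * (1 + b * r) ^ k - c * r ^ n) / r ^ n) \<longlongrightarrow> 0) (at_right 0)" .
  show "\<forall>\<^sub>F r in at_right 0. (r :: real) ^ n \<noteq> 0"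
    using eventually_at_right_less[of "0 :: real"] by eventually_elim simp
qed

text \<open>Transfers asymptotics in the single variable r to pairs (\<tau>, \<theta>); positivity
  of both entries makes the limit one-sided.\<close>

lemma filterlim_ratio_to_0: "filterlim (\<lambda>(\<tau>, \<theta>). \<tau> / \<theta>) (at_right 0) ratio_to_0"
  unfolding filterlim_at ratio_to_0_def
proof (intro conjI)
  show "\<forall>\<^sub>F x in inf (filtercomap (\<lambda>(\<tau>, \<theta>). \<tau> / \<theta>) (nhds 0)) (principal {(\<tau>, \<theta>). 0 < \<tau> \<and> 0 < \<theta>}).
      (case x of (\<tau>, \<theta>) \<Rightarrow> \<tau> / \<theta>) \<in> {0 :: real<..} \<and> (case x of (\<tau>, \<theta>) \<Rightarrow> \<tau> / \<theta>) \<noteq> 0"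
    unfolding eventually_inf_principal by (auto intro: always_eventually)
  show "filterlim (\<lambda>(\<tau>, \<theta>). \<tau> / \<theta>) (nhds (0 :: real))
      (inf (filtercomap (\<lambda>(\<tau>, \<theta>). \<tau> / \<theta>) (nhds 0)) (principal {(\<tau>, \<theta>). 0 < \<tau> \<and> 0 < \<theta>}))"
    by (rule filterlim_mono[OF filterlim_filtercomap]) auto
qed

section \<open>Standing hypotheses and the sublevel sets of \<open>val\<close>\<close>

text \<open>The hypotheses are stated for every dimension \<open>L\<close>, so that the same bounds
  can be applied at K and at K - 1.\<close>

locale projection_setting =
  fixes nrm fd :: "real ^ 'n \<Rightarrow> real"
    and I :: "'i set"
    and \<psi> :: "'i \<Rightarrow> real ^ 'n"
    and \<delta>\<^sub>2 :: real
    and \<delta> :: "'i set \<Rightarrow> real"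
    and \<eta> :: "'i set \<Rightarrow> 'i set \<Rightarrow> real"
    and \<J> :: "nat \<Rightarrow> 'i set set"
  assumes norms: "is_norm nrm" "is_norm fd"
    and dictionary: "finite I" "span (\<psi> ` I) = UNIV"
    and delta_nonneg: "\<And>J. J \<subseteq> I \<Longrightarrow> 0 \<le> \<delta> J"
    and delta_bound: "\<And>J u. J \<subseteq> I \<Longrightarrow> u \<in> (T \<psi> J)\<^sup>\<bottom> \<Longrightarrow> fd u \<le> \<delta> J * h \<psi> nrm J u"
    and J_sub: "\<And>L J. L \<le> CARD('n) \<Longrightarrow> J \<in> \<J> L \<Longrightarrow> J \<subseteq> I \<and> dim (T \<psi> J) = L"
    and J_inj: "\<And>L. L \<le> CARD('n) \<Longrightarrow> inj_on (T \<psi>) (\<J> L)"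
    and J_all: "\<And>L J\<^sub>1. L \<le> CARD('n) \<Longrightarrow> J\<^sub>1 \<subseteq> I \<Longrightarrow> dim (T \<psi> J\<^sub>1) = L \<Longrightarrow>
      \<exists>J\<in>\<J> L. T \<psi> J = T \<psi> J\<^sub>1"
    and J_0: "\<J> 0 = {{}}"
    and eta_nonneg: "\<And>L k J\<^sub>1 J\<^sub>2. L \<le> CARD('n) \<Longrightarrow> k < L \<Longrightarrow> (J\<^sub>1, J\<^sub>2) \<in> H \<psi> \<J> L k \<Longrightarrow>
      0 \<le> \<eta> J\<^sub>1 J\<^sub>2"
    and eta_bound: "\<And>L k J\<^sub>1 J\<^sub>2 \<tau> \<theta>. L \<le> CARD('n) \<Longrightarrow> k < L \<Longrightarrow> (J\<^sub>1, J\<^sub>2) \<in> H \<psi> \<J> L k \<Longrightarrow>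
      0 < \<tau> \<Longrightarrow> 0 < \<theta> \<Longrightarrow> \<eta> J\<^sub>1 J\<^sub>2 * \<tau> \<le> \<theta> \<Longrightarrow>
      measure lborel (Tt \<psi> nrm \<tau> J\<^sub>1 \<inter> Tt \<psi> nrm \<tau> J\<^sub>2 \<inter> lev fd \<theta>)
        \<le> Q \<psi> fd \<delta>\<^sub>2 J\<^sub>1 J\<^sub>2 * \<tau> ^ (CARD('n) - k) * (\<theta> + \<eta> J\<^sub>1 J\<^sub>2 * \<tau>) ^ k"
begin

lemma J_finite: "L \<le> CARD('n) \<Longrightarrow> finite (\<J> L)"
  using J_sub dictionary(1) by (meson Pow_iff finite_Pow_iff finite_subset subsetI)

text \<open>While the span is not the whole space, some atom lies outside it because the dictionary
  spans; adding that atom raises the dimension by exactly one.\<close>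

lemma subset_extend_dim:
  assumes "A \<subseteq> I" "dim (T \<psi> A) \<le> L" "L \<le> CARD('n)"
  shows "\<exists>A'. A \<subseteq> A' \<and> A' \<subseteq> I \<and> dim (T \<psi> A') = L"
  using assms(2,3)
proof (induction L rule: dec_induct)
  case base
  then show ?case
    using assms(1) by blast
next
  case (step L)
  then obtain A' where A': "A \<subseteq> A'" "A' \<subseteq> I" "dim (T \<psi> A') = L"
    by auto
  have "\<exists>i\<in>I. \<psi> i \<notin> span (\<psi> ` A')"
  proof (rule ccontr)
    assume "\<not> ?thesis"
    then have "span (\<psi> ` I) \<subseteq> span (\<psi> ` A')"
      by (intro span_minimal) auto
    then have "T \<psi> A' = UNIV"
      unfolding dictionary(2) T_def by blast
    then show False
      using A'(3) step.prems by simp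
  qed
  then obtain i where i: "i \<in> I" "\<psi> i \<notin> span (\<psi> ` A')"
    by blast
  then have "dim (T \<psi> (insert i A')) = Suc L"
    using A'(3) by (simp add: T_def dim_insert)
  then show ?case
    using A'(1,2) i(1) by (intro exI[of _ "insert i A'"]) blast
qed

text \<open>Forwards, the support of a minimizer has at most L atoms, hence a span of dimension at
  most L, and it is enlarged to dimension exactly L. Backwards, a point of an L-dimensional span is
  a combination of L atoms forming a basis.\<close>

lemma val_le_iff:
  assumes L: "L \<le> CARD('n)" and \<tau>: "0 \<le> \<tau>"
  shows "val \<psi> I nrm \<tau> x \<le> L \<longleftrightarrow> (\<exists>J\<in>\<J> L. x \<in> Tt \<psi> nrm \<tau> J)"
proof
  assume val: "val \<psi> I nrm \<tau> x \<le> L"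
  \<comment> \<open>Exact representability makes the problem feasible, so the \<open>LEAST\<close>
    in \<open>val\<close> is attained.\<close>
  obtain c0 where "x = (\<Sum>i\<in>I. c0 i *\<^sub>R \<psi> i)"
    using span_image_sum[of I x \<psi>] dictionary by auto
  then have "\<exists>n. \<exists>c :: 'i \<Rightarrow> real.
      n = card {i \<in> I. c i \<noteq> 0} \<and> nrm ((\<Sum>i\<in>I. c i *\<^sub>R \<psi> i) - x) \<le> \<tau>"
    using is_norm_eq_0_iff[OF norms(1), of 0] \<tau> by (intro exI[of _ c0] exI) auto
  from LeastI_ex[OF this, folded val_def] obtain c :: "'i \<Rightarrow> real" where
    c: "val \<psi> I nrm \<tau> x = card {i \<in> I. c i \<noteq> 0}" "nrm ((\<Sum>i\<in>I. c i *\<^sub>R \<psi> i) - x) \<le> \<tau>"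
    by blast
  define A where "A = {i \<in> I. c i \<noteq> 0}"
  have A: "A \<subseteq> I" "finite A"
    using dictionary(1) by (auto simp: A_def)
  have "dim (T \<psi> A) \<le> card (\<psi> ` A)"
    unfolding T_def dim_span using A(2) by (intro dim_le_card') simp
  also have "\<dots> \<le> L"
    using card_image_le[OF A(2), of \<psi>] c(1) val by (simp add: A_def)
  finally obtain A' where A': "A \<subseteq> A'" "A' \<subseteq> I" "dim (T \<psi> A') = L"
    using subset_extend_dim[OF A(1) _ L] by blast
  obtain J where J: "J \<in> \<J> L" "T \<psi> J = T \<psi> A'"
    using J_all[OF L A'(2,3)] by blast
  have "(\<Sum>i\<in>I. c i *\<^sub>R \<psi> i) = (\<Sum>i\<in>A. c i *\<^sub>R \<psi> i)"
    using dictionary(1) by (intro sum.mono_neutral_right) (auto simp: A_def)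
  also have "\<dots> \<in> T \<psi> A'"
    unfolding T_def using A'(1) by (intro span_sum span_scale span_base) auto
  finally show "\<exists>J\<in>\<J> L. x \<in> Tt \<psi> nrm \<tau> J"
    using J c(2) mem_Tt_iff[OF norms(1)] by blast
next
  assume "\<exists>J\<in>\<J> L. x \<in> Tt \<psi> nrm \<tau> J"
  then obtain J y where J: "J \<in> \<J> L" and y: "y \<in> T \<psi> J" "nrm (y - x) \<le> \<tau>"
    using mem_Tt_iff[OF norms(1)] by blast
  have JI: "J \<subseteq> I" "dim (T \<psi> J) = L"
    using J_sub[OF L J] by auto
  \<comment> \<open>\<open>J\<close> may contain more than L indices. A basis among its atoms,
    indexed injectively by \<open>A\<close>, limits the support to L.\<close>
  obtain B where B: "B \<subseteq> \<psi> ` J" "independent B" "\<psi> ` J \<subseteq> span B" "card B = dim (\<psi> ` J)"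
    using basis_exists[of "\<psi> ` J"] by metis
  obtain A where A: "A \<subseteq> J" "inj_on \<psi> A" "B = \<psi> ` A"
    using B(1) by (auto simp: subset_image_inj)
  have "T \<psi> J \<subseteq> span (\<psi> ` A)"
    using B(3) by (simp add: T_def A(3) span_minimal)
  moreover have finA: "finite A"
    using A(1) JI(1) dictionary(1) by (meson finite_subset)
  ultimately obtain c where c: "y = (\<Sum>i\<in>A. c i *\<^sub>R \<psi> i)"
    using y(1) span_image_sum[of A y \<psi>] by auto
  define c' where "c' i = (if i \<in> A then c i else 0)" for i
  have "(\<Sum>i\<in>I. c' i *\<^sub>R \<psi> i) = y"
    unfolding c using A(1) JI(1) dictionary(1)
    by (intro sum.mono_neutral_cong_right) (auto simp: c'_def)
  then have "val \<psi> I nrm \<tau> x \<le> card {i \<in> I. c' i \<noteq> 0}"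
    unfolding val_def using y(2) by (intro Least_le) auto
  also have "\<dots> \<le> card A"
    using finA by (intro card_mono) (auto simp: c'_def)
  also have "\<dots> = L"
    using B(4) A(2,3) JI(2) by (simp add: T_def card_image)
  finally show "val \<psi> I nrm \<tau> x \<le> L" .
qed

section \<open>Maximal constants and the thresholds \<open>\<Delta>\<close>\<close>

lemma delta_le_hat: "L \<le> CARD('n) \<Longrightarrow> J \<in> \<J> L \<Longrightarrow> \<delta> J \<le> \<delta>_hat \<J> \<delta> L"
  unfolding \<delta>_hat_def using J_finite by (intro Max_ge) auto

lemma H_subset: "H \<psi> \<J> L k \<subseteq> \<J> L \<times> \<J> L"
  by (auto simp: H_def)

lemma H_finite: "L \<le> CARD('n) \<Longrightarrow> finite (H \<psi> \<J> L k)"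
  using J_finite by (intro finite_subset[OF H_subset]) auto

lemma eta_le_hat: "L \<le> CARD('n) \<Longrightarrow> (J\<^sub>1, J\<^sub>2) \<in> H \<psi> \<J> L k \<Longrightarrow> \<eta> J\<^sub>1 J\<^sub>2 \<le> \<eta>_hat \<psi> \<J> \<eta> L k"
  unfolding \<eta>_hat_def using H_finite by (intro Max_ge) (auto intro!: finite_imageI image_eqI[of _ _ "(J\<^sub>1, J\<^sub>2)"])

lemma delta_hat_le_Delta: "\<delta>_hat \<J> \<delta> L \<le> \<Delta> \<psi> \<J> \<delta> \<eta> L"
  by (cases L) (auto simp: Let_def intro: Max_ge)

lemma eta_hat_le_Delta:
  "L < CARD('n) \<Longrightarrow> k \<in> {2 * L - CARD('n)..<L} \<Longrightarrow> \<eta>_hat \<psi> \<J> \<eta> L k \<le> \<Delta> \<psi> \<J> \<delta> \<eta> L"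
  by (cases L) (auto simp: Let_def simp del: Max_insert intro!: Max_ge)

lemma Delta_Suc: "\<Delta> \<psi> \<J> \<delta> \<eta> L \<le> \<Delta> \<psi> \<J> \<delta> \<eta> (Suc L)"
  by (auto simp: Let_def intro: Max_ge)

text \<open>The empty set spans {0}, so the bound for \<open>\<delta> {}\<close> covers a unit
  vector, where \<open>fd\<close> is positive; hence \<open>\<delta> {}\<close> cannot be 0.
  Monotonicity does the rest. This turns the threshold into \<theta> > 0.\<close>

lemma Delta_pos: "0 < \<Delta> \<psi> \<J> \<delta> \<eta> L"
proof (induction L)
  case 0
  obtain u :: "real ^ 'n" where u: "norm u = 1"
    using vector_choose_size[of 1] by auto
  then have "0 < fd u"
    using is_norm_nonneg[OF norms(2), of u] is_norm_eq_0_iff[OF norms(2), of u] by fastforce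
  also have "fd u \<le> \<delta> {} * h \<psi> nrm {} u"
    by (intro delta_bound) (auto simp: T_def)
  finally have "\<delta> {} \<noteq> 0"
    by auto
  then show ?case
    using delta_nonneg[of "{}"] by (simp add: \<delta>_hat_def J_0)
next
  case (Suc L)
  then show ?case
    using Delta_Suc[of L] by linarith
qed

lemma C_nonneg: "0 \<le> C \<psi> nrm fd J"
  by (simp add: C_def)

lemma Q_nonneg: "0 \<le> Q \<psi> fd \<delta>\<^sub>2 J\<^sub>1 J\<^sub>2"
  by (simp add: Q_def Let_def)

section \<open>Pairs of distinct spans\<close>

text \<open>An intersection of dimension L would coincide with both spans, and distinct members have
  distinct spans. The lower end is the dimension formula for a sum of subspaces, the sum having
  dimension at most N.\<close>

lemma dim_T_Int:
  assumes L: "L \<le> CARD('n)" and J: "J\<^sub>1 \<in> \<J> L" "J\<^sub>2 \<in> \<J> L" "J\<^sub>1 \<noteq> J\<^sub>2"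
  shows "dim (T \<psi> J\<^sub>1 \<inter> T \<psi> J\<^sub>2) \<in> {2 * L - CARD('n)..<L}"
proof -
  let ?A = "T \<psi> J\<^sub>1" and ?B = "T \<psi> J\<^sub>2"
  have dims: "dim ?A = L" "dim ?B = L"
    using J_sub[OF L] J by auto
  have "?A \<noteq> ?B"
    using J_inj[OF L] J by (auto dest: inj_onD)
  have "dim (?A \<inter> ?B) \<noteq> L"
  proof
    assume *: "dim (?A \<inter> ?B) = L"
    have "?A \<inter> ?B = ?A" "?A \<inter> ?B = ?B"
      by (rule subspace_dim_equal; use * dims in \<open>simp add: subspace_inter\<close>)+
    with \<open>?A \<noteq> ?B\<close> show False
      by simp
  qed
  moreover have "dim (?A \<inter> ?B) \<le> L"
    using dim_subset[of "?A \<inter> ?B" ?A] dims by simp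
  moreover have "dim {x + y |x y. x \<in> ?A \<and> y \<in> ?B} + dim (?A \<inter> ?B) = 2 * L"
    using dim_sums_Int[of ?A ?B] dims by simp
  moreover have "dim {x + y |x y. x \<in> ?A \<and> y \<in> ?B} \<le> CARD('n)"
    using dim_subset_UNIV[of "{x + y |x y. x \<in> ?A \<and> y \<in> ?B}"] by simp
  ultimately show ?thesis
    by simp
qed

text \<open>Off-diagonal pairs are grouped by the dimension of the intersection. For k < L the set
  \<open>H\<close> contains no diagonal pair, since a span meets itself in dimension L.\<close>

lemma J_pair_sum:
  assumes L: "L \<le> CARD('n)"
  shows "(\<Sum>k\<in>{2 * L - CARD('n)..<L}. sum g (H \<psi> \<J> L k))
    = sum g {(J\<^sub>1, J\<^sub>2) \<in> \<J> L \<times> \<J> L. J\<^sub>1 \<noteq> J\<^sub>2}"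
proof -
  let ?P = "{(J\<^sub>1, J\<^sub>2) \<in> \<J> L \<times> \<J> L. J\<^sub>1 \<noteq> J\<^sub>2}" and ?R = "{2 * L - CARD('n)..<L}"
  let ?d = "\<lambda>(J\<^sub>1, J\<^sub>2). dim (T \<psi> J\<^sub>1 \<inter> T \<psi> J\<^sub>2)"
  have "finite ?P"
    by (rule finite_subset[of _ "\<J> L \<times> \<J> L"]) (use J_finite[OF L] in auto)
  moreover have "?d ` ?P \<subseteq> ?R"
    using dim_T_Int[OF L] by fast
  ultimately have "(\<Sum>k\<in>?R. sum g {x \<in> ?P. ?d x = k}) = sum g ?P"
    by (intro sum.group) auto
  moreover have "{x \<in> ?P. ?d x = k} = H \<psi> \<J> L k" if "k \<in> ?R" for k
    using that J_sub[OF L] by (fastforce simp: H_def)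
  ultimately show ?thesis
    by simp
qed

text \<open>The case distinction disappears because the index range is empty both for L = 0 and for
  L = N.\<close>

lemma eps0_eq:
  assumes L: "L \<le> CARD('n)"
  shows "eps0 \<psi> fd \<delta>\<^sub>2 \<J> \<eta> L r = (\<Sum>k\<in>{2 * L - CARD('n)..<L}.
      Q_bar \<psi> fd \<delta>\<^sub>2 \<J> L k * r ^ (CARD('n) - k) * (1 + \<eta>_hat \<psi> \<J> \<eta> L k * r) ^ k)"
  using L by (auto simp: eps0_def)

text \<open>The threshold gives \<open>\<eta> J\<^sub>1 J\<^sub>2 * \<tau> \<le> \<theta>\<close>,
  so the pair bound applies. Passing to the maximum \<open>\<eta>_hat\<close> is monotone because
  the base of the power is nonnegative.\<close>

lemma pair_measure_le_eps0:
  assumes L: "L \<le> CARD('n)" and \<tau>: "0 < \<tau>" and \<theta>: "0 < \<theta>" "\<tau> * \<Delta> \<psi> \<J> \<delta> \<eta> L \<le> \<theta>"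
  shows "(\<Sum>(J\<^sub>1, J\<^sub>2)\<in>{(J\<^sub>1, J\<^sub>2) \<in> \<J> L \<times> \<J> L. J\<^sub>1 \<noteq> J\<^sub>2}.
      measure lborel (Tt \<psi> nrm \<tau> J\<^sub>1 \<inter> Tt \<psi> nrm \<tau> J\<^sub>2 \<inter> lev fd \<theta>))
    \<le> \<theta> ^ CARD('n) * eps0 \<psi> fd \<delta>\<^sub>2 \<J> \<eta> L (\<tau> / \<theta>)"
  unfolding J_pair_sum[OF L, symmetric] eps0_eq[OF L] sum_distrib_left
proof (rule sum_mono)
  fix k assume k: "k \<in> {2 * L - CARD('n)..<L}"
  \<comment> \<open>For L = N the range of \<open>k\<close> would be empty; only for L < N does
    \<open>\<Delta>\<close> include the pair constants.\<close>
  have "L < CARD('n)"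
    using L k by auto
  have le: "measure lborel (Tt \<psi> nrm \<tau> J\<^sub>1 \<inter> Tt \<psi> nrm \<tau> J\<^sub>2 \<inter> lev fd \<theta>)
      \<le> Q \<psi> fd \<delta>\<^sub>2 J\<^sub>1 J\<^sub>2 * (\<tau> ^ (CARD('n) - k) * (\<theta> + \<eta>_hat \<psi> \<J> \<eta> L k * \<tau>) ^ k)"
    if H: "(J\<^sub>1, J\<^sub>2) \<in> H \<psi> \<J> L k" for J\<^sub>1 J\<^sub>2
  proof -
    have "\<eta> J\<^sub>1 J\<^sub>2 * \<tau> \<le> \<eta>_hat \<psi> \<J> \<eta> L k * \<tau>"
      using eta_le_hat[OF L H] \<tau> by (intro mult_right_mono) auto
    moreover have "\<eta>_hat \<psi> \<J> \<eta> L k * \<tau> \<le> \<Delta> \<psi> \<J> \<delta> \<eta> L * \<tau>"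
      using eta_hat_le_Delta[OF \<open>L < CARD('n)\<close> k] \<tau> by (intro mult_right_mono) auto
    ultimately have le: "\<eta> J\<^sub>1 J\<^sub>2 * \<tau> \<le> \<theta>" "\<theta> + \<eta> J\<^sub>1 J\<^sub>2 * \<tau> \<le> \<theta> + \<eta>_hat \<psi> \<J> \<eta> L k * \<tau>"
      using \<theta>(2) by (auto simp: mult.commute)
    have k': "k < L"
      using k by simp
    have "0 \<le> \<theta> + \<eta> J\<^sub>1 J\<^sub>2 * \<tau>"
      using eta_nonneg[OF L k' H] \<theta>(1) \<tau> by simp
    then have "Q \<psi> fd \<delta>\<^sub>2 J\<^sub>1 J\<^sub>2 * (\<tau> ^ (CARD('n) - k) * (\<theta> + \<eta> J\<^sub>1 J\<^sub>2 * \<tau>) ^ k)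
        \<le> Q \<psi> fd \<delta>\<^sub>2 J\<^sub>1 J\<^sub>2 * (\<tau> ^ (CARD('n) - k) * (\<theta> + \<eta>_hat \<psi> \<J> \<eta> L k * \<tau>) ^ k)"
      using le(2) \<tau> Q_nonneg by (intro mult_left_mono power_mono) auto
    with eta_bound[OF L k' H \<tau> \<theta>(1) le(1)] show ?thesis
      by (simp add: mult.assoc)
  qed
  have "(\<Sum>(J\<^sub>1, J\<^sub>2)\<in>H \<psi> \<J> L k. measure lborel (Tt \<psi> nrm \<tau> J\<^sub>1 \<inter> Tt \<psi> nrm \<tau> J\<^sub>2 \<inter> lev fd \<theta>))
      \<le> (\<Sum>(J\<^sub>1, J\<^sub>2)\<in>H \<psi> \<J> L k.
          Q \<psi> fd \<delta>\<^sub>2 J\<^sub>1 J\<^sub>2 * (\<tau> ^ (CARD('n) - k) * (\<theta> + \<eta>_hat \<psi> \<J> \<eta> L k * \<tau>) ^ k))"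
    using le by (intro sum_mono) auto
  also have "\<dots> = Q_bar \<psi> fd \<delta>\<^sub>2 \<J> L k * (\<tau> ^ (CARD('n) - k) * (\<theta> + \<eta>_hat \<psi> \<J> \<eta> L k * \<tau>) ^ k)"
    by (simp add: Q_bar_def sum_distrib_right split_beta')
  also have "\<dots> = \<theta> ^ CARD('n) * (Q_bar \<psi> fd \<delta>\<^sub>2 \<J> L k * (\<tau> / \<theta>) ^ (CARD('n) - k)
      * (1 + \<eta>_hat \<psi> \<J> \<eta> L k * (\<tau> / \<theta>)) ^ k)"
    using scale_ratio[OF \<theta>(1), of k "CARD('n)" \<tau>] L k by simp
  finally show "(\<Sum>(J\<^sub>1, J\<^sub>2)\<in>H \<psi> \<J> L k. measure lborel (Tt \<psi> nrm \<tau> J\<^sub>1 \<inter> Tt \<psi> nrm \<tau> J\<^sub>2 \<inter> lev fd \<theta>))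
      \<le> \<theta> ^ CARD('n) * (Q_bar \<psi> fd \<delta>\<^sub>2 \<J> L k * (\<tau> / \<theta>) ^ (CARD('n) - k)
      * (1 + \<eta>_hat \<psi> \<J> \<eta> L k * (\<tau> / \<theta>)) ^ k)" .
qed

section \<open>Volumes of slabs and of their unions\<close>

text \<open>Makes the slab bounds uniform over \<open>\<J> L\<close> by passing to
  \<open>\<delta>_hat\<close>. On the lower side this needs \<theta> - \<open>\<delta>_hat\<close> *
  \<tau> to be nonnegative, which the threshold provides.\<close>

lemma single_measure_bounds:
  assumes L: "L \<le> CARD('n)" and J: "J \<in> \<J> L" and \<tau>: "0 < \<tau>"
    and \<theta>: "0 < \<theta>" "\<tau> * \<Delta> \<psi> \<J> \<delta> \<eta> L \<le> \<theta>"
  defines "r \<equiv> \<tau> / \<theta>" and "m \<equiv> measure lborel (Tt \<psi> nrm \<tau> J \<inter> lev fd \<theta>)"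
  shows "C \<psi> nrm fd J * (\<theta> ^ CARD('n) * (r ^ (CARD('n) - L) * (1 - \<delta>_hat \<J> \<delta> L * r) ^ L)) \<le> m"
    and "m \<le> C \<psi> nrm fd J * (\<theta> ^ CARD('n) * (r ^ (CARD('n) - L) * (1 + \<delta>_hat \<J> \<delta> L * r) ^ L))"
proof -
  have JI: "J \<subseteq> I" "dim (T \<psi> J) = L"
    using J_sub[OF L J] by auto
  have d0: "0 \<le> \<delta> J"
    using delta_nonneg JI by simp
  have le1: "\<delta> J * \<tau> \<le> \<delta>_hat \<J> \<delta> L * \<tau>"
    using delta_le_hat[OF L J] \<tau> by (intro mult_right_mono) auto
  have le2: "\<delta>_hat \<J> \<delta> L * \<tau> \<le> \<theta>"
    using mult_left_mono[OF delta_hat_le_Delta, of \<tau> L] \<theta>(2) \<tau>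
    by (subst mult.commute) linarith
  note b = measure_Tt_lev_bounds[OF norms d0 delta_bound[OF JI(1)] \<tau> order_trans[OF le1 le2] \<theta>(1),
      unfolded JI(2)]
  have "C \<psi> nrm fd J * (\<theta> ^ CARD('n) * (r ^ (CARD('n) - L) * (1 - \<delta>_hat \<J> \<delta> L * r) ^ L))
      = C \<psi> nrm fd J * (\<tau> ^ (CARD('n) - L) * (\<theta> - \<delta>_hat \<J> \<delta> L * \<tau>) ^ L)"
    using scale_ratio[OF \<theta>(1) L, of \<tau> "- \<delta>_hat \<J> \<delta> L"] by (simp add: r_def)
  also have "\<dots> \<le> C \<psi> nrm fd J * (\<tau> ^ (CARD('n) - L) * (\<theta> - \<delta> J * \<tau>) ^ L)"
    using le1 le2 \<tau> C_nonneg by (intro mult_left_mono power_mono) auto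
  also have "\<dots> \<le> m"
    using b(1) by (simp add: m_def mult.assoc)
  finally show "C \<psi> nrm fd J * (\<theta> ^ CARD('n) * (r ^ (CARD('n) - L) * (1 - \<delta>_hat \<J> \<delta> L * r) ^ L)) \<le> m" .
  have "m \<le> C \<psi> nrm fd J * (\<tau> ^ (CARD('n) - L) * (\<theta> + \<delta> J * \<tau>) ^ L)"
    using b(2) by (simp add: m_def mult.assoc)
  also have "\<dots> \<le> C \<psi> nrm fd J * (\<tau> ^ (CARD('n) - L) * (\<theta> + \<delta>_hat \<J> \<delta> L * \<tau>) ^ L)"
    using le1 \<theta>(1) d0 \<tau> C_nonneg by (intro mult_left_mono power_mono) auto
  also have "\<dots> = C \<psi> nrm fd J * (\<theta> ^ CARD('n) * (r ^ (CARD('n) - L) * (1 + \<delta>_hat \<J> \<delta> L * r) ^ L))"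
    using scale_ratio[OF \<theta>(1) L, of \<tau> "\<delta>_hat \<J> \<delta> L"] by (simp add: r_def)
  finally show "m \<le> C \<psi> nrm fd J * (\<theta> ^ CARD('n) * (r ^ (CARD('n) - L) * (1 + \<delta>_hat \<J> \<delta> L * r) ^ L))" .
qed

lemma sublevel_eq:
  assumes "L \<le> CARD('n)" "0 < \<tau>"
  shows "{x. val \<psi> I nrm \<tau> x \<le> L} = (\<Union>J\<in>\<J> L. Tt \<psi> nrm \<tau> J)"
  using val_le_iff[OF assms(1), of \<tau>] assms(2) by auto

lemma sublevel_borel:
  assumes "L \<le> CARD('n)" "0 < \<tau>"
  shows "{x. val \<psi> I nrm \<tau> x \<le> L} \<in> sets borel"
  unfolding sublevel_eq[OF assms] using J_finite[OF assms(1)] Tt_closed[OF norms(1)]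
  by (intro borel_closed closed_UN) auto

lemma sublevel_measure_bounds:
  assumes L: "L \<le> CARD('n)" and \<tau>: "0 < \<tau>" and \<theta>: "0 < \<theta>" "\<tau> * \<Delta> \<psi> \<J> \<delta> \<eta> L \<le> \<theta>"
  defines "r \<equiv> \<tau> / \<theta>"
    and "m \<equiv> measure lborel ({x. val \<psi> I nrm \<tau> x \<le> L} \<inter> lev fd \<theta>)"
  shows "\<theta> ^ CARD('n) * (C_bar \<psi> nrm fd \<J> L * r ^ (CARD('n) - L) * (1 - \<delta>_hat \<J> \<delta> L * r) ^ L
      - eps0 \<psi> fd \<delta>\<^sub>2 \<J> \<eta> L r) \<le> m"
    and "m \<le> \<theta> ^ CARD('n) * (C_bar \<psi> nrm fd \<J> L * r ^ (CARD('n) - L) * (1 + \<delta>_hat \<J> \<delta> L * r) ^ L)"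
proof -
  let ?S = "\<lambda>J. Tt \<psi> nrm \<tau> J \<inter> lev fd \<theta>"
  have S: "?S J \<in> fmeasurable lborel" for J
  proof -
    have "compact (?S J)"
      using Tt_closed[OF norms(1)] lev_is_norm_compact[OF norms(2)] by (rule closed_Int_compact)
    then show ?thesis
      using borel_compact emeasure_compact_finite by (intro fmeasurableI) auto
  qed
  have m: "m = measure lborel (\<Union>J\<in>\<J> L. ?S J)"
    unfolding m_def sublevel_eq[OF L \<tau>] by (simp add: Int_UN_distrib2)
  note single = single_measure_bounds[OF L _ \<tau> \<theta>, folded r_def]
  have "\<theta> ^ CARD('n) * (C_bar \<psi> nrm fd \<J> L * r ^ (CARD('n) - L) * (1 - \<delta>_hat \<J> \<delta> L * r) ^ L)
      = (\<Sum>J\<in>\<J> L. C \<psi> nrm fd J * (\<theta> ^ CARD('n) * (r ^ (CARD('n) - L) * (1 - \<delta>_hat \<J> \<delta> L * r) ^ L)))"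
    unfolding sum_distrib_right[symmetric] by (simp add: C_bar_def mult_ac)
  also have "\<dots> \<le> (\<Sum>J\<in>\<J> L. measure lborel (?S J))"
    by (intro sum_mono single(1))
  also have "\<dots> \<le> m + (\<Sum>(J\<^sub>1, J\<^sub>2)\<in>{(J\<^sub>1, J\<^sub>2) \<in> \<J> L \<times> \<J> L. J\<^sub>1 \<noteq> J\<^sub>2}. measure lborel (?S J\<^sub>1 \<inter> ?S J\<^sub>2))"
    using measure_UNION_ge[OF J_finite[OF L], of ?S lborel, OF S] unfolding m by linarith
  also have "(\<Sum>(J\<^sub>1, J\<^sub>2)\<in>{(J\<^sub>1, J\<^sub>2) \<in> \<J> L \<times> \<J> L. J\<^sub>1 \<noteq> J\<^sub>2}. measure lborel (?S J\<^sub>1 \<inter> ?S J\<^sub>2))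
      \<le> \<theta> ^ CARD('n) * eps0 \<psi> fd \<delta>\<^sub>2 \<J> \<eta> L r"
    using pair_measure_le_eps0[OF L \<tau> \<theta>] unfolding r_def
    by (simp add: Int_ac Int_left_absorb)
  finally show "\<theta> ^ CARD('n) * (C_bar \<psi> nrm fd \<J> L * r ^ (CARD('n) - L) * (1 - \<delta>_hat \<J> \<delta> L * r) ^ L
      - eps0 \<psi> fd \<delta>\<^sub>2 \<J> \<eta> L r) \<le> m"
    by (simp add: right_diff_distrib)
  have "m \<le> (\<Sum>J\<in>\<J> L. measure lborel (?S J))"
    unfolding m using J_finite[OF L] by (intro measure_UNION_le fmeasurableD S)
  also have "\<dots> \<le> (\<Sum>J\<in>\<J> L. C \<psi> nrm fd J * (\<theta> ^ CARD('n) * (r ^ (CARD('n) - L) * (1 + \<delta>_hat \<J> \<delta> L * r) ^ L)))"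
    by (intro sum_mono single(2))
  also have "\<dots> = \<theta> ^ CARD('n) * (C_bar \<psi> nrm fd \<J> L * r ^ (CARD('n) - L) * (1 + \<delta>_hat \<J> \<delta> L * r) ^ L)"
    unfolding sum_distrib_right[symmetric] by (simp add: C_bar_def mult_ac)
  finally show "m \<le> \<theta> ^ CARD('n) * (C_bar \<psi> nrm fd \<J> L * r ^ (CARD('n) - L) * (1 + \<delta>_hat \<J> \<delta> L * r) ^ L)" .
qed

section \<open>Bounds on the probability\<close>

text \<open>With \<open>prob_upper\<close>, the two sides of the finite estimate as functions of the
  ratio alone, so that they can also squeeze the probability in the limit.\<close>

definition prob_lower :: "nat \<Rightarrow> real \<Rightarrow> real" where
  "prob_lower K r = C_bar \<psi> nrm fd \<J> K / measure lborel (lev fd 1) * r ^ (CARD('n) - K) *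
      (1 - \<delta>_hat \<J> \<delta> K * r) ^ K
    - eps0' \<psi> nrm fd \<delta>\<^sub>2 \<J> \<delta> \<eta> K r / measure lborel (lev fd 1)"

definition prob_upper :: "nat \<Rightarrow> real \<Rightarrow> real" where
  "prob_upper K r = C_bar \<psi> nrm fd \<J> K / measure lborel (lev fd 1) * r ^ (CARD('n) - K) *
      (1 + \<delta>_hat \<J> \<delta> K * r) ^ K
    + eps1 \<psi> nrm fd \<delta>\<^sub>2 \<J> \<delta> \<eta> K r / measure lborel (lev fd 1)"

text \<open>The event is a difference of nested sublevel sets, so its volume is
  \<open>F K - F m\<close> with m = K - 1, and subtraction pairs opposite bounds at the two
  levels.\<close>

lemma prob_bounds:
  assumes K: "K \<le> CARD('n)" and \<tau>: "0 < \<tau>"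
    and \<theta>: "\<tau> * max (\<Delta> \<psi> \<J> \<delta> \<eta> K) (case K of 0 \<Rightarrow> 0 | Suc m \<Rightarrow> \<Delta> \<psi> \<J> \<delta> \<eta> m) \<le> \<theta>"
    and d: "uniform_rv M d (lev fd \<theta>)"
  shows "prob_lower K (\<tau> / \<theta>) \<le> measure M {\<omega> \<in> space M. val \<psi> I nrm \<tau> (d \<omega>) = K}"
    and "measure M {\<omega> \<in> space M. val \<psi> I nrm \<tau> (d \<omega>) = K} \<le> prob_upper K (\<tau> / \<theta>)"
proof -
  define V where "V = measure lborel (lev fd 1)"
  define F where "F L = measure lborel ({x. val \<psi> I nrm \<tau> x \<le> L} \<inter> lev fd \<theta>)" for L
  let ?N = "CARD('n)" and ?r = "\<tau> / \<theta>"
  have V: "0 < V"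
    unfolding V_def using measure_lev_is_norm_pos[OF norms(2)] by simp
  have \<theta>K: "\<tau> * \<Delta> \<psi> \<J> \<delta> \<eta> K \<le> \<theta>"
    using \<theta> \<tau> mult_left_mono[of "\<Delta> \<psi> \<J> \<delta> \<eta> K" _ \<tau>] by (meson less_imp_le max.cobounded1 order_trans)
  have \<theta>0: "0 < \<theta>"
    using mult_pos_pos[OF \<tau> Delta_pos[of K]] \<theta>K by linarith
  note F_bounds = sublevel_measure_bounds[OF _ \<tau> \<theta>0, folded F_def]
  have F_fin: "{x. val \<psi> I nrm \<tau> x \<le> L} \<inter> lev fd \<theta> \<in> fmeasurable lborel" if "L \<le> ?N" for L
  proof -
    have "lev fd \<theta> \<in> fmeasurable lborel"
      using lev_is_norm_compact[OF norms(2), of \<theta>] borel_compact emeasure_compact_finite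
      by (intro fmeasurableI) auto
    then show ?thesis
      using sublevel_borel[OF that \<tau>] by (subst Int_commute) (auto intro: fmeasurable_Int_fmeasurable)
  qed
  have tN: "0 < \<theta> ^ ?N"
    using \<theta>0 by simp
  let ?P = "measure M {\<omega> \<in> space M. val \<psi> I nrm \<tau> (d \<omega>) = K}"
  have "prob_lower K ?r \<le> ?P \<and> ?P \<le> prob_upper K ?r"
  proof (cases K)
    \<comment> \<open>There is no level below 0, so nothing is subtracted; this agrees with the zero
      terms of index -1.\<close>
    case 0
    have "{x. val \<psi> I nrm \<tau> x \<le> 0} = {x. val \<psi> I nrm \<tau> x = K}"
      using 0 by simp
    then have P: "?P = F K / (\<theta> ^ ?N * V)"
      using measure_uniform_rv[OF norms(2) \<theta>0 d sublevel_borel[OF K \<tau>]] 0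
      unfolding F_def V_def by simp
    have div: "\<theta> ^ ?N * a / (\<theta> ^ ?N * V) = a / V" for a
      using \<theta>0 by simp
    have "\<theta> ^ ?N * (C_bar \<psi> nrm fd \<J> K * ?r ^ (?N - K) * (1 - \<delta>_hat \<J> \<delta> K * ?r) ^ K
        - eps0 \<psi> fd \<delta>\<^sub>2 \<J> \<eta> K ?r) / (\<theta> ^ ?N * V) \<le> ?P"
      unfolding P using F_bounds(1)[OF K \<theta>K] tN V by (intro divide_right_mono) auto
    moreover have "?P \<le> \<theta> ^ ?N * (C_bar \<psi> nrm fd \<J> K * ?r ^ (?N - K)
        * (1 + \<delta>_hat \<J> \<delta> K * ?r) ^ K) / (\<theta> ^ ?N * V)"
      unfolding P using F_bounds(2)[OF K \<theta>K] tN V by (intro divide_right_mono) auto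
    ultimately show ?thesis
      unfolding div prob_lower_def prob_upper_def V_def[symmetric]
      by (simp add: eps0'_def eps1_def 0 diff_divide_distrib)
  next
    case (Suc m)
    then have m: "m \<le> ?N"
      using K by simp
    \<comment> \<open>The threshold at K implies the one at K - 1, since \<open>\<Delta>\<close> is
      nondecreasing.\<close>
    have \<theta>m: "\<tau> * \<Delta> \<psi> \<J> \<delta> \<eta> m \<le> \<theta>"
      by (rule order_trans[OF mult_left_mono[OF Delta_Suc]]) (use \<theta>K \<tau> Suc in auto)
    have diff: "{x. val \<psi> I nrm \<tau> x = K} = {x. val \<psi> I nrm \<tau> x \<le> K} - {x. val \<psi> I nrm \<tau> x \<le> m}"
      using Suc by auto
    have "{x. val \<psi> I nrm \<tau> x = K} \<in> sets borel"
      unfolding diff using sublevel_borel[OF K \<tau>] sublevel_borel[OF m \<tau>] by (rule sets.Diff)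
    from measure_uniform_rv[OF norms(2) \<theta>0 d this]
    have "?P = measure lborel ({x. val \<psi> I nrm \<tau> x = K} \<inter> lev fd \<theta>) / (\<theta> ^ ?N * V)"
      by (simp add: V_def)
    also have "measure lborel ({x. val \<psi> I nrm \<tau> x = K} \<inter> lev fd \<theta>) = F K - F m"
    proof -
      have "{x. val \<psi> I nrm \<tau> x = K} \<inter> lev fd \<theta>
          = ({x. val \<psi> I nrm \<tau> x \<le> K} \<inter> lev fd \<theta>) - ({x. val \<psi> I nrm \<tau> x \<le> m} \<inter> lev fd \<theta>)"
        unfolding diff by auto
      also have "measure lborel \<dots> = F K - F m"
        unfolding F_def using F_fin[OF K] F_fin[OF m] Suc
        by (intro measure_Diff) (auto simp: fmeasurable_def)
      finally show ?thesis .
    qed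
    finally have P: "?P = (F K - F m) / (\<theta> ^ ?N * V)" .
    have div: "(\<theta> ^ ?N * a - \<theta> ^ ?N * b) / (\<theta> ^ ?N * V) = a / V - b / V" for a b
      using \<theta>0 by (simp add: diff_divide_distrib flip: right_diff_distrib)
    have "(\<theta> ^ ?N * (C_bar \<psi> nrm fd \<J> K * ?r ^ (?N - K) * (1 - \<delta>_hat \<J> \<delta> K * ?r) ^ K
          - eps0 \<psi> fd \<delta>\<^sub>2 \<J> \<eta> K ?r)
        - \<theta> ^ ?N * (C_bar \<psi> nrm fd \<J> m * ?r ^ (?N - m) * (1 + \<delta>_hat \<J> \<delta> m * ?r) ^ m))
        / (\<theta> ^ ?N * V) \<le> ?P"
      unfolding P using F_bounds(1)[OF K \<theta>K] F_bounds(2)[OF m \<theta>m] tN V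
      by (intro divide_right_mono diff_mono) auto
    then have 1: "prob_lower K ?r \<le> ?P"
      unfolding div prob_lower_def V_def[symmetric]
      by (simp add: eps0'_def Suc diff_divide_distrib add_divide_distrib)
    have "?P \<le> (\<theta> ^ ?N * (C_bar \<psi> nrm fd \<J> K * ?r ^ (?N - K) * (1 + \<delta>_hat \<J> \<delta> K * ?r) ^ K)
        - \<theta> ^ ?N * (C_bar \<psi> nrm fd \<J> m * ?r ^ (?N - m) * (1 - \<delta>_hat \<J> \<delta> m * ?r) ^ m
          - eps0 \<psi> fd \<delta>\<^sub>2 \<J> \<eta> m ?r)) / (\<theta> ^ ?N * V)"
      unfolding P using F_bounds(2)[OF K \<theta>K] F_bounds(1)[OF m \<theta>m] tN V
      by (intro divide_right_mono diff_mono) auto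
    then have 2: "?P \<le> prob_upper K ?r"
      unfolding div prob_upper_def V_def[symmetric]
      by (simp add: eps1_def Suc diff_divide_distrib add_divide_distrib)
    show ?thesis
      using 1 2 by blast
  qed
  then show "prob_lower K ?r \<le> ?P" "?P \<le> prob_upper K ?r"
    by auto
qed

section \<open>Asymptotics as the ratio tends to 0\<close>

text \<open>Every exponent is N - k with k < L \<le> K, hence larger than N - K. The case L = K
  serves \<open>eps0'\<close>, the case L = K - 1 serves \<open>eps1\<close>.\<close>

lemma eps0_smallo:
  assumes "L \<le> K" "K \<le> CARD('n)"
  shows "eps0 \<psi> fd \<delta>\<^sub>2 \<J> \<eta> L \<in> o[at_right 0](\<lambda>r. r ^ (CARD('n) - K))"
proof -
  have "L \<le> CARD('n)"
    using assms by simp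
  show ?thesis
    unfolding eps0_eq[OF \<open>L \<le> CARD('n)\<close>, abs_def]
    using assms by (intro big_sum_in_smallo monomial_smallo_at_right_0) auto
qed

lemma prob_lower_smallo:
  assumes K: "K \<le> CARD('n)"
  shows "(\<lambda>r. prob_lower K r - C_bar \<psi> nrm fd \<J> K / measure lborel (lev fd 1) * r ^ (CARD('n) - K))
    \<in> o[at_right 0](\<lambda>r. r ^ (CARD('n) - K))"
proof -
  let ?o = "o[at_right 0](\<lambda>r::real. r ^ (CARD('n) - K))" and ?V = "measure lborel (lev fd 1)"
  have "eps0' \<psi> nrm fd \<delta>\<^sub>2 \<J> \<delta> \<eta> K \<in> ?o"
  proof (cases K)
    case (Suc m)
    have "(\<lambda>r. C_bar \<psi> nrm fd \<J> m * r ^ (CARD('n) - m) * (1 + \<delta>_hat \<J> \<delta> m * r) ^ m) \<in> ?o"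
      using Suc K by (intro monomial_smallo_at_right_0) auto
    then show ?thesis
      using sum_in_smallo(1)[OF eps0_smallo[OF order_refl K]] by (simp add: eps0'_def[abs_def] Suc)
  qed (use eps0_smallo[OF order_refl K] in \<open>simp add: eps0'_def[abs_def]\<close>)
  then have "(\<lambda>r. eps0' \<psi> nrm fd \<delta>\<^sub>2 \<J> \<delta> \<eta> K r / ?V) \<in> ?o"
    using measure_lev_is_norm_pos[OF norms(2), of 1] by simp
  from sum_in_smallo(2)[OF monomial_diff_smallo_at_right_0[of "C_bar \<psi> nrm fd \<J> K / ?V" _ "- \<delta>_hat \<J> \<delta> K" K] this]
  show ?thesis
    by (simp add: prob_lower_def algebra_simps)
qed

lemma prob_upper_smallo:
  assumes K: "K \<le> CARD('n)"
  shows "(\<lambda>r. prob_upper K r - C_bar \<psi> nrm fd \<J> K / measure lborel (lev fd 1) * r ^ (CARD('n) - K))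
    \<in> o[at_right 0](\<lambda>r. r ^ (CARD('n) - K))"
proof -
  let ?o = "o[at_right 0](\<lambda>r::real. r ^ (CARD('n) - K))" and ?V = "measure lborel (lev fd 1)"
  have "eps1 \<psi> nrm fd \<delta>\<^sub>2 \<J> \<delta> \<eta> K \<in> ?o"
  proof (cases K)
    case (Suc m)
    have "(\<lambda>r. C_bar \<psi> nrm fd \<J> m * r ^ (CARD('n) - m) * (1 + (- \<delta>_hat \<J> \<delta> m) * r) ^ m) \<in> ?o"
      using Suc K by (intro monomial_smallo_at_right_0) auto
    then show ?thesis
      using sum_in_smallo(2)[OF eps0_smallo[OF _ K, of m]] Suc by (simp add: eps1_def[abs_def])
  qed (simp add: eps1_def[abs_def])
  then have "(\<lambda>r. eps1 \<psi> nrm fd \<delta>\<^sub>2 \<J> \<delta> \<eta> K r / ?V) \<in> ?o"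
    using measure_lev_is_norm_pos[OF norms(2), of 1] by simp
  from sum_in_smallo(1)[OF monomial_diff_smallo_at_right_0[of "C_bar \<psi> nrm fd \<J> K / ?V" _ "\<delta>_hat \<J> \<delta> K" K] this]
  show ?thesis
    by (simp add: prob_upper_def algebra_simps)
qed

text \<open>A squeeze between \<open>prob_lower\<close> and \<open>prob_upper\<close>. Both depend
  on the ratio only, so the estimate is uniform over all pairs with the same ratio, whatever
  probability space belongs to each \<theta>.\<close>

lemma prob_asymp:
  assumes K: "K \<le> CARD('n)" and d: "\<And>\<theta>. 0 < \<theta> \<Longrightarrow> uniform_rv (M \<theta>) (d \<theta>) (lev fd \<theta>)"
  shows "(\<lambda>(\<tau>, \<theta>). measure (M \<theta>) {\<omega> \<in> space (M \<theta>). val \<psi> I nrm \<tau> (d \<theta> \<omega>) = K}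
      - C_bar \<psi> nrm fd \<J> K / measure lborel (lev fd 1) * (\<tau> / \<theta>) ^ (CARD('n) - K))
    \<in> o[ratio_to_0](\<lambda>(\<tau>, \<theta>). (\<tau> / \<theta>) ^ (CARD('n) - K))"
proof (rule landau_o.smallI)
  fix c :: real assume c: "0 < c"
  let ?A = "C_bar \<psi> nrm fd \<J> K / measure lborel (lev fd 1)" and ?n = "CARD('n) - K"
  let ?m = "max (\<Delta> \<psi> \<J> \<delta> \<eta> K) (case K of 0 \<Rightarrow> 0 | Suc m \<Rightarrow> \<Delta> \<psi> \<J> \<delta> \<eta> m)"
  \<comment> \<open>Once r * \<open>?m\<close> < 1 the threshold condition holds, so the finite
    bounds apply to all sufficiently small ratios.\<close>
  have "((\<lambda>r. r * ?m) \<longlongrightarrow> 0 * ?m) (at_right 0)"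
    by (intro tendsto_intros)
  then have "\<forall>\<^sub>F r in at_right 0. r * ?m < 1"
    by (rule order_tendstoD) simp
  then have "\<forall>\<^sub>F r in at_right 0. r * ?m < 1
      \<and> norm (prob_lower K r - ?A * r ^ ?n) \<le> c * norm (r ^ ?n)
      \<and> norm (prob_upper K r - ?A * r ^ ?n) \<le> c * norm (r ^ ?n)"
    using landau_o.smallD[OF prob_lower_smallo[OF K] c] landau_o.smallD[OF prob_upper_smallo[OF K] c]
    by eventually_elim simp
  then have "\<forall>\<^sub>F (\<tau>, \<theta>) in ratio_to_0. (\<tau> / \<theta>) * ?m < 1
      \<and> norm (prob_lower K (\<tau> / \<theta>) - ?A * (\<tau> / \<theta>) ^ ?n) \<le> c * norm ((\<tau> / \<theta>) ^ ?n)
      \<and> norm (prob_upper K (\<tau> / \<theta>) - ?A * (\<tau> / \<theta>) ^ ?n) \<le> c * norm ((\<tau> / \<theta>) ^ ?n)"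
    using filterlim_ratio_to_0 by (auto simp: filterlim_iff split_beta')
  moreover have "\<forall>\<^sub>F (\<tau>, \<theta>) in ratio_to_0. 0 < \<tau> \<and> 0 < \<theta>"
    unfolding ratio_to_0_def eventually_inf_principal by (auto intro: always_eventually)
  ultimately show "\<forall>\<^sub>F x in ratio_to_0.
      norm (case x of (\<tau>, \<theta>) \<Rightarrow> measure (M \<theta>) {\<omega> \<in> space (M \<theta>). val \<psi> I nrm \<tau> (d \<theta> \<omega>) = K}
        - ?A * (\<tau> / \<theta>) ^ ?n) \<le> c * norm (case x of (\<tau>, \<theta>) \<Rightarrow> (\<tau> / \<theta>) ^ ?n)"
  proof eventually_elim
    case (elim x)
    obtain \<tau> \<theta> where x: "x = (\<tau>, \<theta>)"
      by fastforce
    have \<tau>\<theta>: "0 < \<tau>" "0 < \<theta>" and le: "(\<tau> / \<theta>) * ?m < 1"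
      and lo: "norm (prob_lower K (\<tau> / \<theta>) - ?A * (\<tau> / \<theta>) ^ ?n) \<le> c * norm ((\<tau> / \<theta>) ^ ?n)"
      and up: "norm (prob_upper K (\<tau> / \<theta>) - ?A * (\<tau> / \<theta>) ^ ?n) \<le> c * norm ((\<tau> / \<theta>) ^ ?n)"
      using elim by (simp_all add: x)
    have "\<tau> * ?m \<le> \<theta>"
      using le \<tau>\<theta>(2) by (simp add: field_simps)
    note b = prob_bounds[OF K \<tau>\<theta>(1) this d[OF \<tau>\<theta>(2)]]
    have "norm (measure (M \<theta>) {\<omega> \<in> space (M \<theta>). val \<psi> I nrm \<tau> (d \<theta> \<omega>) = K} - ?A * (\<tau> / \<theta>) ^ ?n)
        \<le> c * norm ((\<tau> / \<theta>) ^ ?n)"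
      using b lo up unfolding real_norm_def by linarith
    then show ?case
      by (simp add: x)
  qed
qed

end

text \<open>The law of \<open>d\<close> changes with \<theta>, so the limit claim takes one
  probability space and one random variable for each \<theta> > 0; \<tau> and \<theta> may vary
  together in any way that sends their ratio to 0.\<close>

theorem theorem4:
  fixes nrm fd :: "real ^ 'n \<Rightarrow> real"
    and I :: "'i set"
    and \<psi> :: "'i \<Rightarrow> real ^ 'n"
    and \<delta>\<^sub>1 \<delta>\<^sub>2 :: real
    and \<delta> :: "'i set \<Rightarrow> real"
    and \<eta> :: "'i set \<Rightarrow> 'i set \<Rightarrow> real"
    and \<J> :: "nat \<Rightarrow> 'i set set"
    and K :: nat
  assumes norms: "is_norm nrm" "is_norm fd"
    and dictionary: "finite I" "span (\<psi> ` I) = UNIV"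
    and delta12: "0 < \<delta>\<^sub>1" "0 < \<delta>\<^sub>2"
      "\<And>w. fd w \<le> \<delta>\<^sub>1 * norm w" "\<And>w. norm w \<le> \<delta>\<^sub>2 * nrm w"
    and delta_range: "\<And>J. J \<subseteq> I \<Longrightarrow> 0 \<le> \<delta> J \<and> \<delta> J \<le> \<delta>\<^sub>1 * \<delta>\<^sub>2"
    and delta_bound: "\<And>J u. J \<subseteq> I \<Longrightarrow> u \<in> (T \<psi> J)\<^sup>\<bottom> \<Longrightarrow> fd u \<le> \<delta> J * h \<psi> nrm J u"
    and J_sub: "\<And>L J. L \<le> CARD('n) \<Longrightarrow> J \<in> \<J> L \<Longrightarrow> J \<subseteq> I \<and> dim (T \<psi> J) = L"
    and J_inj: "\<And>L. L \<le> CARD('n) \<Longrightarrow> inj_on (T \<psi>) (\<J> L)"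
    and J_all: "\<And>L J\<^sub>1. L \<le> CARD('n) \<Longrightarrow> J\<^sub>1 \<subseteq> I \<Longrightarrow> dim (T \<psi> J\<^sub>1) = L \<Longrightarrow>
      \<exists>J\<in>\<J> L. T \<psi> J = T \<psi> J\<^sub>1"
    and J_0: "\<J> 0 = {{}}"
    and eta_range: "\<And>L k J\<^sub>1 J\<^sub>2. L \<le> CARD('n) \<Longrightarrow> k < L \<Longrightarrow> (J\<^sub>1, J\<^sub>2) \<in> H \<psi> \<J> L k \<Longrightarrow>
      0 \<le> \<eta> J\<^sub>1 J\<^sub>2 \<and> \<eta> J\<^sub>1 J\<^sub>2 \<le> 3 * (\<delta>\<^sub>1 * \<delta>\<^sub>2)"
    and eta_bound: "\<And>L k J\<^sub>1 J\<^sub>2 \<tau> \<theta>. L \<le> CARD('n) \<Longrightarrow> k < L \<Longrightarrow> (J\<^sub>1, J\<^sub>2) \<in> H \<psi> \<J> L k \<Longrightarrow>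
      0 < \<tau> \<Longrightarrow> 0 < \<theta> \<Longrightarrow> \<eta> J\<^sub>1 J\<^sub>2 * \<tau> \<le> \<theta> \<Longrightarrow>
      measure lborel (Tt \<psi> nrm \<tau> J\<^sub>1 \<inter> Tt \<psi> nrm \<tau> J\<^sub>2 \<inter> lev fd \<theta>)
        \<le> Q \<psi> fd \<delta>\<^sub>2 J\<^sub>1 J\<^sub>2 * \<tau> ^ (CARD('n) - k) * (\<theta> + \<eta> J\<^sub>1 J\<^sub>2 * \<tau>) ^ k"
    and K: "K \<le> CARD('n)"
  shows
    "(\<forall>\<tau> \<theta> (M :: 'w measure) d.
        0 < \<tau> \<and>
        \<tau> * max (\<Delta> \<psi> \<J> \<delta> \<eta> K) (case K of 0 \<Rightarrow> 0 | Suc m \<Rightarrow> \<Delta> \<psi> \<J> \<delta> \<eta> m) \<le> \<theta> \<and>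
        uniform_rv M d (lev fd \<theta>) \<longrightarrow>
        C_bar \<psi> nrm fd \<J> K / measure lborel (lev fd 1) * (\<tau> / \<theta>) ^ (CARD('n) - K) *
            (1 - \<delta>_hat \<J> \<delta> K * (\<tau> / \<theta>)) ^ K
          - eps0' \<psi> nrm fd \<delta>\<^sub>2 \<J> \<delta> \<eta> K (\<tau> / \<theta>) / measure lborel (lev fd 1)
        \<le> measure M {\<omega> \<in> space M. val \<psi> I nrm \<tau> (d \<omega>) = K} \<and>
        measure M {\<omega> \<in> space M. val \<psi> I nrm \<tau> (d \<omega>) = K}
        \<le> C_bar \<psi> nrm fd \<J> K / measure lborel (lev fd 1) * (\<tau> / \<theta>) ^ (CARD('n) - K) *
            (1 + \<delta>_hat \<J> \<delta> K * (\<tau> / \<theta>)) ^ K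
          + eps1 \<psi> nrm fd \<delta>\<^sub>2 \<J> \<delta> \<eta> K (\<tau> / \<theta>) / measure lborel (lev fd 1))
     \<and>
     (\<forall>(M :: real \<Rightarrow> 'w measure) d.
        (\<forall>\<theta>>0. uniform_rv (M \<theta>) (d \<theta>) (lev fd \<theta>)) \<longrightarrow>
        (\<lambda>(\<tau>, \<theta>). measure (M \<theta>) {\<omega> \<in> space (M \<theta>). val \<psi> I nrm \<tau> (d \<theta> \<omega>) = K}
                  - C_bar \<psi> nrm fd \<J> K / measure lborel (lev fd 1) * (\<tau> / \<theta>) ^ (CARD('n) - K))
          \<in> o[ratio_to_0](\<lambda>(\<tau>, \<theta>). (\<tau> / \<theta>) ^ (CARD('n) - K)))"
proof -
  interpret projection_setting nrm fd I \<psi> \<delta>\<^sub>2 \<delta> \<eta> \<J>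
  proof
    show "0 \<le> \<delta> J" if "J \<subseteq> I" for J
      using delta_range[OF that] by simp
    show "0 \<le> \<eta> J\<^sub>1 J\<^sub>2" if "L \<le> CARD('n)" "k < L" "(J\<^sub>1, J\<^sub>2) \<in> H \<psi> \<J> L k" for L k J\<^sub>1 J\<^sub>2
      using eta_range[OF that] by simp
  qed (rule norms dictionary delta_bound J_sub J_inj J_all J_0 eta_bound; assumption)+
  show ?thesis
  proof (intro conjI allI impI)
    fix \<tau> \<theta> :: real and M :: "'w measure" and d
    assume "0 < \<tau> \<and>
        \<tau> * max (\<Delta> \<psi> \<J> \<delta> \<eta> K) (case K of 0 \<Rightarrow> 0 | Suc m \<Rightarrow> \<Delta> \<psi> \<J> \<delta> \<eta> m) \<le> \<theta> \<and>
        uniform_rv M d (lev fd \<theta>)"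
    then show "C_bar \<psi> nrm fd \<J> K / measure lborel (lev fd 1) * (\<tau> / \<theta>) ^ (CARD('n) - K) *
            (1 - \<delta>_hat \<J> \<delta> K * (\<tau> / \<theta>)) ^ K
          - eps0' \<psi> nrm fd \<delta>\<^sub>2 \<J> \<delta> \<eta> K (\<tau> / \<theta>) / measure lborel (lev fd 1)
        \<le> measure M {\<omega> \<in> space M. val \<psi> I nrm \<tau> (d \<omega>) = K}"
      "measure M {\<omega> \<in> space M. val \<psi> I nrm \<tau> (d \<omega>) = K}
        \<le> C_bar \<psi> nrm fd \<J> K / measure lborel (lev fd 1) * (\<tau> / \<theta>) ^ (CARD('n) - K) *
            (1 + \<delta>_hat \<J> \<delta> K * (\<tau> / \<theta>)) ^ K
          + eps1 \<psi> nrm fd \<delta>\<^sub>2 \<J> \<delta> \<eta> K (\<tau> / \<theta>) / measure lborel (lev fd 1)"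
      using prob_bounds[OF K, of \<tau> \<theta> M d] by (simp_all only: prob_lower_def prob_upper_def)
  next
    fix M :: "real \<Rightarrow> 'w measure" and d
    assume "\<forall>\<theta>>0. uniform_rv (M \<theta>) (d \<theta>) (lev fd \<theta>)"
    then show "(\<lambda>(\<tau>, \<theta>). measure (M \<theta>) {\<omega> \<in> space (M \<theta>). val \<psi> I nrm \<tau> (d \<theta> \<omega>) = K}
        - C_bar \<psi> nrm fd \<J> K / measure lborel (lev fd 1) * (\<tau> / \<theta>) ^ (CARD('n) - K))
      \<in> o[ratio_to_0](\<lambda>(\<tau>, \<theta>). (\<tau> / \<theta>) ^ (CARD('n) - K))"
      by (intro prob_asymp[OF K]) blast
  qed
qed

end
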